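(* There is an $O\big((\log^{3/2}U)\,\log(1/\delta)/\varepsilon\big)$-word turnstile streaming algorithm for $\mathsf{AR}(\varepsilon,\delta,n,U)$. Similarly, there is an $O\big((\log^{3/2}U)\,\log(1/(\varepsilon\delta))/\varepsilon+\log\log U\big)$-word turnstile streaming algorithm for $\mathsf{AQ}(\varepsilon,\delta,n,U)$.
   Context: Fix $\varepsilon\in(0,1)$ and $\delta\in(0,1)$. In a strict turnstile stream over $[U]=\{1,\dots,U\}$, a vector $x$ starts at $0$ and receives updates $x_u\leftarrow x_u+\Delta$ ($\Delta$ may be negative), with $x_u\ge0$ for all $u$; the stream produces $x\in\mathbb{R}_{\ge0}^U$ of size $n=\lceil\|x\|_1\rceil$. Write $\mathrm{rank}(u)=\sum_{v\le u}x_v$. Approximate rank, $\mathsf{AR}(\varepsilon,\delta,n,U)$: for each $u\in[U]$, the query $\mathsf{rank}(u)$ must be answered with a value within additive error $\pm\varepsilon n$ of $\mathrm{rank}(u)$, with probability at least $1-\delta$. Approximate quantile, $\mathsf{AQ}(\varepsilon,\delta,n,U)$: each query $q\in[n]$ must be answered by an index $u\in[U]$ with $\mathrm{rank}(u)\ge q-\varepsilon n$ and $\mathrm{rank}(u-1)\le q+\varepsilon n$, with probability at least $1-\delta$. In both problems the success probability is for each query individually, not simultaneously for all queries. Memory is counted in machine words, one word storing one counter. Hidden constants are absolute.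
   Formalization: For approximate quantile, queries q in [n] having no admissible index u (possible since n is the 1-norm rounded up, e.g. norm 0.1, n = q = 1, ε = 1/2) are exempt; U ≥ 2 is assumed; the word bound is rounded up to a whole number of words. *)

theory Defs
  imports "HOL-Probability.Probability"
begin

section \<open>Strict turnstile streams\<close>

text \<open>A stream is the list of its updates \<open>(u, \<Delta>)\<close>, in order of arrival.\<close>

type_synonym stream = "(nat \<times> real) list"

definition stream_vec :: "stream \<Rightarrow> nat \<Rightarrow> real" where
  "stream_vec \<sigma> u = (\<Sum>(v, \<Delta>)\<leftarrow>\<sigma>. if v = u then \<Delta> else 0)"

text \<open>Strictness: the entries are nonnegative after every update, not only at the end.\<close>

definition strict_turnstile :: "nat \<Rightarrow> stream \<Rightarrow> bool" where
  "strict_turnstile U \<sigma> \<longleftrightarrow>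
     fst ` set \<sigma> \<subseteq> {1..U} \<and>
     (\<forall>t\<le>length \<sigma>. \<forall>u\<in>{1..U}. stream_vec (take t \<sigma>) u \<ge> 0)"

definition stream_size :: "nat \<Rightarrow> stream \<Rightarrow> nat" where
  "stream_size U \<sigma> = nat \<lceil>\<Sum>u\<in>{1..U}. \<bar>stream_vec \<sigma> u\<bar>\<rceil>"

definition stream_rank :: "stream \<Rightarrow> nat \<Rightarrow> real" where
  "stream_rank \<sigma> u = (\<Sum>v\<in>{1..u}. stream_vec \<sigma> v)"


section \<open>Randomized streaming algorithms with word-counted memory\<close>

text \<open>
  The memory consists of \<open>num_words\<close> integer words (hash seeds and any other control information,
  of the bounded size required by \<open>runs_in_memory\<close>) and \<open>num_counters\<close> counters. Everything that is remembered
  between two updates, random choices included, has to be stored there.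

  On an update \<open>(u, \<Delta>)\<close> the algorithm inspects the memory and the update, possibly tosses coins,
  rewrites the integer words arbitrarily and adds \<open>-\<Delta>\<close>, \<open>0\<close> or \<open>\<Delta>\<close> to each counter (\<open>step\<close> returns
  the new integer words and these coefficients). The updates are real numbers, and if a word could
  hold an arbitrary real function of the past, a single word could encode the whole vector. Here a
  counter is always a signed sum of updates, so its absolute value is at most the sum of the
  \<open>\<bar>\<Delta>\<bar>\<close>, and it is an integer if all updates are.

  Neither the size \<open>n\<close> of the final vector nor the length of the stream is known to the algorithm.
\<close>

type_synonym memory = "nat list \<times> real list"

record ('q, 'a) streaming_alg =
  num_words :: nat
  num_counters :: nat
  init :: "nat list pmf"
  step :: "nat \<times> real \<Rightarrow> memory \<Rightarrow> (nat list \<times> int list) pmf"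
  answer :: "'q \<Rightarrow> memory \<Rightarrow> 'a pmf"

definition memory_size :: "('q, 'a) streaming_alg \<Rightarrow> nat" where
  "memory_size A = num_words A + num_counters A"

text \<open>All integer words are smaller than \<open>W\<close>, i.e. have \<open>log 2 W\<close> bits.\<close>

definition word_lists :: "real \<Rightarrow> nat \<Rightarrow> nat list set" where
  "word_lists W k = {ws. length ws = k \<and> (\<forall>w\<in>set ws. real w < W)}"

definition runs_in_memory :: "real \<Rightarrow> ('q, 'a) streaming_alg \<Rightarrow> bool" where
  "runs_in_memory W A \<longleftrightarrow>
     set_pmf (init A) \<subseteq> word_lists W (num_words A) \<and>
     (\<forall>upd. \<forall>ws\<in>word_lists W (num_words A). \<forall>cs. length cs = num_counters A \<longrightarrow>
        set_pmf (step A upd (ws, cs)) \<subseteq>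
          word_lists W (num_words A) \<times> {ds. length ds = num_counters A \<and> set ds \<subseteq> {-1, 0, 1}})"

definition init_memory :: "('q, 'a) streaming_alg \<Rightarrow> memory pmf" where
  "init_memory A = map_pmf (\<lambda>ws. (ws, replicate (num_counters A) 0)) (init A)"

definition update_memory :: "('q, 'a) streaming_alg \<Rightarrow> nat \<times> real \<Rightarrow> memory \<Rightarrow> memory pmf" where
  "update_memory A upd m =
     map_pmf (\<lambda>(ws, ds). (ws, map2 (\<lambda>c d. c + of_int d * snd upd) (snd m) ds)) (step A upd m)"

definition run :: "('q, 'a) streaming_alg \<Rightarrow> stream \<Rightarrow> memory pmf" where
  "run A \<sigma> = fold (\<lambda>upd M. bind_pmf M (update_memory A upd)) \<sigma> (init_memory A)"

definition response :: "('q, 'a) streaming_alg \<Rightarrow> stream \<Rightarrow> 'q \<Rightarrow> 'a pmf" where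
  "response A \<sigma> q = bind_pmf (run A \<sigma>) (answer A q)"


section \<open>Approximate rank and approximate quantile\<close>

definition rank_answers :: "real \<Rightarrow> nat \<Rightarrow> stream \<Rightarrow> nat \<Rightarrow> real set" where
  "rank_answers \<epsilon> U \<sigma> u = {r. \<bar>r - stream_rank \<sigma> u\<bar> \<le> \<epsilon> * real (stream_size U \<sigma>)}"

definition quantile_answers :: "real \<Rightarrow> nat \<Rightarrow> stream \<Rightarrow> nat \<Rightarrow> nat set" where
  "quantile_answers \<epsilon> U \<sigma> q =
     {u \<in> {1..U}. stream_rank \<sigma> u \<ge> real q - \<epsilon> * real (stream_size U \<sigma>) \<and>
                  stream_rank \<sigma> (u - 1) \<le> real q + \<epsilon> * real (stream_size U \<sigma>)}"

text \<open>
  In both problems the success probability is per query: the quantifier over the queries is outside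
  the probability.
\<close>

definition solves_AR :: "real \<Rightarrow> real \<Rightarrow> nat \<Rightarrow> (nat, real) streaming_alg \<Rightarrow> bool" where
  "solves_AR \<epsilon> \<delta> U A \<longleftrightarrow>
     (\<forall>\<sigma>. strict_turnstile U \<sigma> \<longrightarrow> (\<forall>u\<in>{1..U}.
        measure_pmf.prob (response A \<sigma> u) (rank_answers \<epsilon> U \<sigma> u) \<ge> 1 - \<delta>))"

text \<open>
  Because \<open>n\<close> is the 1-norm rounded up, a query \<open>q \<le> n\<close> may have no admissible answer at all: if the
  norm is \<open>1/10\<close>, then \<open>n = 1\<close>, and for \<open>q = 1\<close> and \<open>\<epsilon> = 1/2\<close> no index has rank at least
  \<open>q - \<epsilon> * n\<close>. Nothing is required for such queries. They do not exist if the norm is an integer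
  or if \<open>\<epsilon> * n \<ge> 1\<close>; see \<open>quantile_answers_nonempty_iff\<close> and the two facts after it.
\<close>

definition solves_AQ :: "real \<Rightarrow> real \<Rightarrow> nat \<Rightarrow> (nat, nat) streaming_alg \<Rightarrow> bool" where
  "solves_AQ \<epsilon> \<delta> U A \<longleftrightarrow>
     (\<forall>\<sigma>. strict_turnstile U \<sigma> \<longrightarrow> (\<forall>q\<in>{1..stream_size U \<sigma>}.
        quantile_answers \<epsilon> U \<sigma> q \<noteq> {} \<longrightarrow>
        measure_pmf.prob (response A \<sigma> q) (quantile_answers \<epsilon> U \<sigma> q) \<ge> 1 - \<delta>))"

lemma stream_vec_nonneg:
  assumes "strict_turnstile U \<sigma>" "u \<in> {1..U}"
  shows "stream_vec \<sigma> u \<ge> 0"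
  using assms unfolding strict_turnstile_def by (metis order_refl take_all)

lemma stream_size_eq:
  assumes "strict_turnstile U \<sigma>"
  shows "real (stream_size U \<sigma>) = of_int \<lceil>stream_rank \<sigma> U\<rceil>"
proof -
  have "(\<Sum>u\<in>{1..U}. \<bar>stream_vec \<sigma> u\<bar>) = stream_rank \<sigma> U"
    unfolding stream_rank_def by (intro sum.cong refl abs_of_nonneg stream_vec_nonneg[OF assms])
  moreover have "stream_rank \<sigma> U \<ge> 0"
    unfolding stream_rank_def by (intro sum_nonneg stream_vec_nonneg[OF assms])
  ultimately show ?thesis
    unfolding stream_size_def by simp
qed

lemma quantile_answers_nonempty_iff:
  assumes "strict_turnstile U \<sigma>" "U \<ge> 1" "\<epsilon> \<ge> 0"
  shows "quantile_answers \<epsilon> U \<sigma> q \<noteq> {} \<longleftrightarrow>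
         stream_rank \<sigma> U \<ge> real q - \<epsilon> * real (stream_size U \<sigma>)"
proof
  assume "quantile_answers \<epsilon> U \<sigma> q \<noteq> {}"
  then obtain u where u: "u \<in> {1..U}" "stream_rank \<sigma> u \<ge> real q - \<epsilon> * real (stream_size U \<sigma>)"
    unfolding quantile_answers_def by blast
  have "stream_rank \<sigma> u \<le> stream_rank \<sigma> U"
    unfolding stream_rank_def using u(1)
    by (intro sum_mono2) (auto intro: stream_vec_nonneg[OF assms(1)])
  with u(2) show "stream_rank \<sigma> U \<ge> real q - \<epsilon> * real (stream_size U \<sigma>)" by linarith
next
  let ?e = "\<epsilon> * real (stream_size U \<sigma>)"
  let ?P = "\<lambda>u. 1 \<le> u \<and> stream_rank \<sigma> u \<ge> real q - ?e"
  assume "stream_rank \<sigma> U \<ge> real q - ?e"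
  then have PU: "?P U" using assms(2) by simp
  define u where "u = (LEAST u. ?P u)"
  have Pu: "?P u" unfolding u_def using PU by (rule LeastI)
  have uU: "u \<le> U" unfolding u_def using PU by (rule Least_le)
  have e0: "?e \<ge> 0" using assms(3) by simp
  have "stream_rank \<sigma> (u - 1) \<le> real q + ?e"
  proof (cases "u = 1")
    case True
    then show ?thesis using e0 by (simp add: stream_rank_def)
  next
    case False
    then have "u - 1 < u" "1 \<le> u - 1" using Pu by auto
    then have "\<not> ?P (u - 1)" unfolding u_def using not_less_Least by blast
    then show ?thesis using \<open>1 \<le> u - 1\<close> e0 by linarith
  qed
  then show "quantile_answers \<epsilon> U \<sigma> q \<noteq> {}"
    unfolding quantile_answers_def using Pu uU by auto
qed

lemma quantile_answers_nonempty_if_large: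
  assumes "strict_turnstile U \<sigma>" "U \<ge> 1" "\<epsilon> \<ge> 0"
    and "q \<le> stream_size U \<sigma>" "\<epsilon> * real (stream_size U \<sigma>) \<ge> 1"
  shows "quantile_answers \<epsilon> U \<sigma> q \<noteq> {}"
proof -
  have "real q \<le> real (stream_size U \<sigma>)" using assms(4) by simp
  then have "real q < stream_rank \<sigma> U + 1"
    unfolding stream_size_eq[OF assms(1)] by linarith
  then show ?thesis
    unfolding quantile_answers_nonempty_iff[OF assms(1-3)] using assms(5) by linarith
qed

lemma quantile_answers_nonempty_if_integral:
  assumes "strict_turnstile U \<sigma>" "U \<ge> 1" "\<epsilon> \<ge> 0"
    and "q \<le> stream_size U \<sigma>" "stream_rank \<sigma> U \<in> \<int>"
  shows "quantile_answers \<epsilon> U \<sigma> q \<noteq> {}"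
proof -
  have "real (stream_size U \<sigma>) = stream_rank \<sigma> U"
    unfolding stream_size_eq[OF assms(1)] using assms(5) by (auto elim: Ints_cases)
  moreover have "real q \<le> real (stream_size U \<sigma>)" using assms(4) by simp
  moreover have "\<epsilon> * real (stream_size U \<sigma>) \<ge> 0" using assms(3) by simp
  ultimately show ?thesis
    unfolding quantile_answers_nonempty_iff[OF assms(1-3)] by linarith
qed

end

theory Submission
  imports Defs
begin

text \<open>
  Both algorithms use one linear sketch. Fix a dyadic tree over the universe with \<open>L = O(log U)\<close>
  levels, and let every level have three hash tables with \<open>w = O(sqrt L / \<epsilon>)\<close> buckets, with
  pairwise independent hash functions and signs. The first two tables are Count-Min tables. Descending
  from the root and keeping only the blocks whose Count-Min estimate exceeds \<open>8 S / w\<close>, where \<open>S\<close> is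
  the norm, leaves \<open>O(w)\<close> blocks per level in expectation: a false positive survives with probability at
  most \<open>1/4\<close> and has two children, so the branching is subcritical. Subtracting the Count-Min estimates
  of the surviving blocks leaves a residual with expected squared norm \<open>O(S\<^sup>2 / w)\<close>. The third table
  is a signed Count-Sketch table, independent of the first two. Applied to the residual it gives an
  unbiased estimate of each block with variance \<open>O(S\<^sup>2 / w\<^sup>2)\<close>. The signs make the bias vanish exactly,
  so the errors of the \<open>L\<close> levels add up in variance, and by Kolmogorov's inequality all partial
  sums along a fixed root-to-leaf path are \<open>O(sqrt L * S / w) = O(\<epsilon> S)\<close> with constant probability.

  This is approximate rank. A greedy search for a quantile would choose its path depending on the errors,
  which are then no longer centred. Instead, any leaf is returned whose path passes all comparisons with the
  query up to a slack \<open>a\<close>. Three fixed paths (to the quantiles \<open>q\<close>, \<open>q - 2a\<close> and \<open>q + 2a\<close>)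
  being accurate ensures that such a leaf exists and that every such leaf is correct: a leaf beyond one of
  the two outer quantiles fails the comparison at the node where its path leaves the path to that quantile.

  A majority vote over \<open>O(log (1/\<delta>))\<close> copies boosts the success probability. When \<open>\<delta>\<close> is close to 1,
  the admitted memory tends to a single word. There approximate rank is solved with the larger error
  \<open>\<epsilon> / (4 (1 - \<delta>))\<close> and a random guess of the remaining shift; for quantiles with \<open>\<epsilon> \<ge> 1/2\<close> the norm alone
  suffices.
\<close>

section \<open>Expectations under finitely supported probability mass functions\<close>


abbreviation pexp :: "'a pmf \<Rightarrow> ('a \<Rightarrow> real) \<Rightarrow> real" where
  "pexp p f \<equiv> measure_pmf.expectation p f"

lemma pexp_mono:
  assumes "finite (set_pmf p)" "\<And>x. x \<in> set_pmf p \<Longrightarrow> f x \<le> g x"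
  shows "pexp p f \<le> pexp p g"
  using assms by (intro integral_mono_AE integrable_measure_pmf_finite) (auto simp: AE_measure_pmf_iff)

lemma pexp_cong:
  assumes "\<And>x. x \<in> set_pmf p \<Longrightarrow> f x = g x"
  shows "pexp p f = pexp p g"
  using assms by (intro integral_cong_AE) (auto simp: AE_measure_pmf_iff)

lemma pexp_add:
  assumes "finite (set_pmf p)"
  shows "pexp p (\<lambda>x. f x + g x) = pexp p f + pexp p g"
  using assms by (intro Bochner_Integration.integral_add integrable_measure_pmf_finite)

lemma pexp_sum:
  assumes "finite (set_pmf p)"
  shows "pexp p (\<lambda>x. \<Sum>i\<in>I. f i x) = (\<Sum>i\<in>I. pexp p (f i))"
  using assms by (intro Bochner_Integration.integral_sum integrable_measure_pmf_finite)

lemma pexp_bind: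
  assumes "finite (set_pmf p)" "\<And>x. x \<in> set_pmf p \<Longrightarrow> finite (set_pmf (q x))"
  shows "pexp (bind_pmf p q) f = pexp p (\<lambda>x. pexp (q x) f)"
  using assms by (subst pmf_expectation_bind[of "set_pmf p"]) (auto simp: integral_measure_pmf[of "set_pmf p"])

lemma pexp_pair:
  assumes "finite (set_pmf p)" "finite (set_pmf q)"
  shows "pexp (pair_pmf p q) f = pexp p (\<lambda>x. pexp q (\<lambda>y. f (x, y)))"
  unfolding pair_pmf_def using assms by (simp add: pexp_bind)

lemma prob_eq_pexp: "measure_pmf.prob p A = pexp p (indicat_real A)"
  by simp

lemma prob_bind:
  assumes "finite (set_pmf p)" "\<And>x. x \<in> set_pmf p \<Longrightarrow> finite (set_pmf (q x))"
  shows "measure_pmf.prob (bind_pmf p q) A = pexp p (\<lambda>x. measure_pmf.prob (q x) A)"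
  unfolding prob_eq_pexp by (rule pexp_bind[OF assms])

lemma prob_pair:
  assumes "finite (set_pmf p)" "finite (set_pmf q)"
  shows "measure_pmf.prob (pair_pmf p q) {z. Q (fst z) (snd z)} = pexp p (\<lambda>x. measure_pmf.prob q {y. Q x y})"
  unfolding prob_eq_pexp by (subst pexp_pair[OF assms]) (simp add: indicator_def[abs_def] flip: prob_eq_pexp)

lemma markov_pmf:
  assumes "finite (set_pmf p)" "c > 0" "\<And>x. x \<in> set_pmf p \<Longrightarrow> f x \<ge> 0"
    "\<And>x. x \<in> set_pmf p \<Longrightarrow> x \<in> A \<Longrightarrow> f x \<ge> c"
  shows "measure_pmf.prob p A \<le> pexp p f / c"
proof -
  have "measure_pmf.prob p A \<le> pexp p (\<lambda>x. f x / c)"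
    unfolding prob_eq_pexp using assms by (intro pexp_mono) (auto simp: indicator_def)
  then show ?thesis by simp
qed

lemma pmf_prob_mono:
  assumes "\<And>x. x \<in> set_pmf p \<Longrightarrow> x \<in> A \<Longrightarrow> x \<in> A'"
  shows "measure_pmf.prob p A \<le> measure_pmf.prob p A'"
  using assms by (intro measure_pmf.finite_measure_mono_AE) (auto simp: AE_measure_pmf_iff)

section \<open>Finite product distributions\<close>

lemma finite_set_Pi_pmf:
  assumes "finite A" "\<And>x. x \<in> A \<Longrightarrow> finite (set_pmf (p x))"
  shows "finite (set_pmf (Pi_pmf A d p))"
  using assms by (simp add: set_Pi_pmf finite_PiE_dflt)

text \<open>Splitting off coordinate \<open>a\<close> shows that the value drawn first is
  overwritten while the other coordinates are independent of it. This allows averaging over the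
  seeds of one level while all other levels stay fixed.\<close>

lemma Pi_pmf_resample:
  assumes "finite A" "a \<in> A"
  shows "Pi_pmf A d p = bind_pmf (Pi_pmf A d p) (\<lambda>f. map_pmf (\<lambda>y. f(a := y)) (p a))"
proof -
  have A: "A = insert a (A - {a})" using assms by blast
  let ?Q = "Pi_pmf (A - {a}) d p"
  have eq: "Pi_pmf A d p = bind_pmf (p a) (\<lambda>y. map_pmf (\<lambda>f. f(a := y)) ?Q)"
    by (subst A, subst Pi_pmf_insert')
       (use assms in \<open>auto simp: map_pmf_def\<close>)
  have "bind_pmf (Pi_pmf A d p) (\<lambda>f. map_pmf (\<lambda>y. f(a := y)) (p a)) =
        bind_pmf (p a) (\<lambda>y'. bind_pmf ?Q (\<lambda>f. map_pmf (\<lambda>y. f(a := y)) (p a)))"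
  proof -
    have "fun_upd (f(a := y')) a = fun_upd f a" for f :: "'a \<Rightarrow> 'b" and y'
      by (rule ext) simp
    then show ?thesis unfolding eq by (simp add: bind_assoc_pmf bind_map_pmf)
  qed
  also have "\<dots> = bind_pmf ?Q (\<lambda>f. map_pmf (\<lambda>y. f(a := y)) (p a))"
    by simp
  also have "\<dots> = bind_pmf (p a) (\<lambda>y. map_pmf (\<lambda>f. f(a := y)) ?Q)"
    unfolding map_pmf_def by (rule bind_commute_pmf)
  finally show ?thesis using eq by simp
qed

lemma pexp_Pi_resample:
  assumes "finite A" "a \<in> A" "\<And>x. x \<in> A \<Longrightarrow> finite (set_pmf (p x))"
  shows "pexp (Pi_pmf A d p) F = pexp (Pi_pmf A d p) (\<lambda>f. pexp (p a) (\<lambda>y. F (f(a := y))))"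
  by (subst Pi_pmf_resample[OF assms(1,2)], subst pexp_bind) (use assms in \<open>auto simp: finite_set_Pi_pmf\<close>)

lemma pexp_Pi_component:
  assumes "finite A" "a \<in> A" "\<And>x. x \<in> A \<Longrightarrow> finite (set_pmf (p x))"
  shows "pexp (Pi_pmf A d p) (\<lambda>f. F (f a)) = pexp (p a) F"
proof -
  have "pexp (Pi_pmf A d p) (\<lambda>f. F (f a)) = pexp (map_pmf (\<lambda>f. f a) (Pi_pmf A d p)) F" by simp
  then show ?thesis using assms by (simp add: Pi_pmf_component)
qed

lemma pexp_Pi_insert:
  assumes "finite A" "a \<notin> A" "\<And>x. x \<in> insert a A \<Longrightarrow> finite (set_pmf (p x))"
  shows "pexp (Pi_pmf (insert a A) d p) F = pexp (p a) (\<lambda>y. pexp (Pi_pmf A d p) (\<lambda>f. F (f(a := y))))"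
  using assms by (simp add: Pi_pmf_insert finite_set_Pi_pmf pexp_pair case_prod_unfold)

lemma card_set_Pi_pmf_le:
  assumes "finite A" "\<And>x. x \<in> A \<Longrightarrow> finite (set_pmf (p x)) \<and> card (set_pmf (p x)) \<le> n"
  shows "card (set_pmf (Pi_pmf A d p)) \<le> n ^ card A"
proof -
  have "card (set_pmf (Pi_pmf A d p)) = (\<Prod>x\<in>A. card (set_pmf (p x)))"
    using assms by (simp add: set_Pi_pmf card_PiE_dflt)
  also have "\<dots> \<le> (\<Prod>x\<in>A. n)" using assms by (intro prod_mono) auto
  finally show ?thesis by simp
qed

section \<open>A maximal inequality, and amplification by repetition\<close>

text \<open>The sum runs from the top level \<open>n - 1\<close> downwards, the order in which a search path visits the
  levels. The induction is over \<open>n\<close> with the offset \<open>s\<close> of the partial sums arbitrary: if \<open>\<bar>s\<bar> > a\<close>,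
  the bound is at least 1, and otherwise the first step only raises the second moment.\<close>

lemma kolmogorov_maximal:
  fixes e :: "nat \<Rightarrow> 'a \<Rightarrow> real"
  assumes fin: "\<And>i. i < n \<Longrightarrow> finite (set_pmf (q i))"
    and mean: "\<And>i. i < n \<Longrightarrow> pexp (q i) (e i) = 0"
    and var: "\<And>i. i < n \<Longrightarrow> pexp (q i) (\<lambda>y. (e i y)\<^sup>2) \<le> V i"
    and a: "a > 0"
  shows "measure_pmf.prob (Pi_pmf {..<n} d q) {f. \<exists>h\<le>n. \<bar>s + (\<Sum>i\<in>{h..<n}. e i (f i))\<bar> > a}
           \<le> (s\<^sup>2 + (\<Sum>i<n. V i)) / a\<^sup>2"
  using fin mean var
proof (induction n arbitrary: s)
  case 0
  have "a\<^sup>2 \<le> s\<^sup>2" if "a < \<bar>s\<bar>" using that a by (simp add: abs_le_square_iff[symmetric])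
  with a show ?case by (auto simp: indicator_def)
next
  case (Suc n)
  let ?B = "\<lambda>m s. {f. \<exists>h\<le>m. \<bar>s + (\<Sum>i\<in>{h..<m}. e i (f i))\<bar> > a}"
  have V0: "V i \<ge> 0" if "i < Suc n" for i
  proof -
    have "0 \<le> pexp (q i) (\<lambda>y. (e i y)\<^sup>2)" by (intro integral_nonneg_AE) auto
    then show ?thesis using Suc.prems(3)[OF that] by linarith
  qed
  have fin: "finite (set_pmf (q n))" using Suc.prems(1) by simp
  show ?case
  proof (cases "\<bar>s\<bar> > a")
    case True
    then have "a\<^sup>2 \<le> s\<^sup>2" using a by (simp add: abs_le_square_iff[symmetric])
    moreover have "(\<Sum>i<Suc n. V i) \<ge> 0" using V0 by (intro sum_nonneg) auto
    ultimately have "1 \<le> (s\<^sup>2 + (\<Sum>i<Suc n. V i)) / a\<^sup>2" using a by (simp add: field_simps)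
    then show ?thesis using measure_pmf.prob_le_1 order_trans by blast
  next
    case False
    \<comment> \<open>The choice \<open>h = Suc n\<close> leaves the empty sum and hence the event
      \<open>a < \<bar>s\<bar>\<close>, excluded in this case. Every other partial sum contains
      level \<open>n\<close>, whose term moves into the offset.\<close>
    have upd: "(f(n := y)) \<in> ?B (Suc n) s \<longleftrightarrow> f \<in> ?B n (s + e n y)" for f y
    proof -
      have *: "(\<Sum>i\<in>{h..<Suc n}. e i ((f(n := y)) i)) = e n y + (\<Sum>i\<in>{h..<n}. e i (f i))" if "h \<le> n" for h
        using that by simp
      have "(f(n := y)) \<in> ?B (Suc n) s \<longleftrightarrow>
          (\<exists>h\<le>n. \<bar>s + (\<Sum>i\<in>{h..<Suc n}. e i ((f(n := y)) i))\<bar> > a)"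
        using False by (auto simp: le_Suc_eq simp del: sum.op_ivl_Suc)
      also have "\<dots> \<longleftrightarrow> f \<in> ?B n (s + e n y)"
        using * by (auto simp only: mem_Collect_eq add.assoc)
      finally show ?thesis .
    qed
    have "measure_pmf.prob (Pi_pmf {..<Suc n} d q) (?B (Suc n) s) =
          pexp (q n) (\<lambda>y. measure_pmf.prob (Pi_pmf {..<n} d q) (?B n (s + e n y)))"
      unfolding prob_eq_pexp lessThan_Suc
      using Suc.prems(1) by (subst pexp_Pi_insert) (auto simp only: indicator_def[abs_def] upd finite_lessThan lessThan_iff less_irrefl simp flip: lessThan_Suc)
    also have "\<dots> \<le> pexp (q n) (\<lambda>y. ((s + e n y)\<^sup>2 + (\<Sum>i<n. V i)) / a\<^sup>2)"
      using Suc.prems by (intro pexp_mono[OF fin] Suc.IH) auto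
    also have "\<dots> = (s\<^sup>2 + 2 * s * pexp (q n) (e n) + pexp (q n) (\<lambda>y. (e n y)\<^sup>2) + (\<Sum>i<n. V i)) / a\<^sup>2"
      by (simp add: power2_sum pexp_add[OF fin] algebra_simps)
    also have "\<dots> \<le> (s\<^sup>2 + (\<Sum>i<Suc n. V i)) / a\<^sup>2"
      using Suc.prems(2,3)[of n] by (intro divide_right_mono) auto
    finally show ?thesis .
  qed
qed

text \<open>Markov's inequality for 16 raised to the number of failures.\<close>

lemma majority_fails:
  assumes fin: "finite (set_pmf D)" and bad: "measure_pmf.prob D B \<le> 1/16"
  shows "measure_pmf.prob (Pi_pmf {..<R::nat} d (\<lambda>_. D)) {f. 2 * card {i\<in>{..<R}. f i \<notin> B} \<le> R} \<le> 1 / 2 ^ R"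
proof -
  let ?P = "\<lambda>R::nat. Pi_pmf {..<R} d (\<lambda>_. D)"
  let ?c = "\<lambda>R f. card {i\<in>{..<R::nat}. f i \<in> B}"
  have finP: "finite (set_pmf (?P R))" for R using fin by (intro finite_set_Pi_pmf) auto
  have one: "pexp D (\<lambda>y. if y \<in> B then 16 else 1) \<le> 2"
  proof -
    have "pexp D (\<lambda>y. if y \<in> B then 16 else 1) = pexp D (\<lambda>y. 1 + 15 * indicat_real B y)"
      by (intro pexp_cong) auto
    also have "\<dots> = 1 + 15 * measure_pmf.prob D B" by (subst pexp_add[OF fin]) simp
    finally show ?thesis using bad by simp
  qed
  have main: "pexp (?P R) (\<lambda>f. 16 ^ ?c R f) \<le> 2 ^ R" for R
  proof (induction R)
    case (Suc R)
    have cnt: "?c (Suc R) (f(R := y)) = (if y \<in> B then Suc (?c R f) else ?c R f)" for f y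
    proof -
      have "{i\<in>{..<Suc R}. (f(R := y)) i \<in> B} = (if y \<in> B then insert R {i\<in>{..<R}. f i \<in> B} else {i\<in>{..<R}. f i \<in> B})"
        by (auto simp: less_Suc_eq)
      then show ?thesis by simp
    qed
    have "pexp (?P (Suc R)) (\<lambda>f. 16 ^ ?c (Suc R) f) =
          pexp D (\<lambda>y. pexp (?P R) (\<lambda>f. 16 ^ ?c (Suc R) (f(R := y))))"
      unfolding lessThan_Suc using fin by (subst pexp_Pi_insert) auto
    also have "\<dots> = pexp D (\<lambda>y. (if y \<in> B then 16 else 1) * pexp (?P R) (\<lambda>f. 16 ^ ?c R f))"
      unfolding cnt by (intro pexp_cong) auto
    also have "\<dots> = pexp D (\<lambda>y. if y \<in> B then 16 else 1) * pexp (?P R) (\<lambda>f. 16 ^ ?c R f)"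
      by simp
    also have "\<dots> \<le> 2 * 2 ^ R" by (intro mult_mono one Suc.IH) auto
    finally show ?case by simp
  qed simp
  \<comment> \<open>If at least half of the copies fail, the counting variable is at least
    \<open>16 ^ (R / 2) = 4 ^ R\<close>, while its mean is at most \<open>2 ^ R\<close>.\<close>
  have "measure_pmf.prob (?P R) {f. 2 * card {i\<in>{..<R}. f i \<notin> B} \<le> R} \<le> pexp (?P R) (\<lambda>f. 16 ^ ?c R f) / 4 ^ R"
  proof (rule markov_pmf[OF finP])
    fix f assume "f \<in> {f. 2 * card {i\<in>{..<R}. f i \<notin> B} \<le> R}"
    moreover have "card {i\<in>{..<R}. f i \<notin> B} + ?c R f = card {..<R}"
      by (subst card_Un_disjoint[symmetric]) (auto simp del: card_lessThan intro!: arg_cong[where f=card])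
    ultimately have "R \<le> 2 * ?c R f" by simp
    then have "(4::real) ^ R \<le> 4 ^ (2 * ?c R f)" by (intro power_increasing) auto
    also have "\<dots> = 16 ^ ?c R f" by (simp add: power_mult)
    finally show "4 ^ R \<le> (16::real) ^ ?c R f" .
  qed auto
  also have "\<dots> \<le> 2 ^ R / 4 ^ R" by (intro divide_right_mono main) auto
  also have "\<dots> = 1 / (2::real) ^ R"
    by (simp add: field_simps flip: power_mult_distrib)
  finally show ?thesis .
qed

text \<open>A vote over acceptance relations instead of a median: a copy may accept many answers,
  and a good copy accepts \<open>a\<close> and nothing outside \<open>G\<close>. If more than half
  of the copies are good, \<open>a\<close> is a majority answer, so the choice is well defined; any
  two majorities share a copy, so whatever is chosen is accepted by a good copy and lies in
  \<open>G\<close>.\<close>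

lemma prob_majority_choice:
  assumes fin: "finite (set_pmf D)"
    and bad: "measure_pmf.prob D {s. \<not> (acc s a \<and> (\<forall>b. acc s b \<longrightarrow> b \<in> G))} \<le> 1/16"
  shows "measure_pmf.prob (Pi_pmf {..<R::nat} d (\<lambda>_. D))
           {f. (SOME b. R < 2 * card {i\<in>{..<R}. acc (f i) b}) \<in> G} \<ge> 1 - 1 / 2 ^ R"
proof -
  let ?P = "Pi_pmf {..<R} d (\<lambda>_. D)"
  let ?B = "{s. \<not> (acc s a \<and> (\<forall>b. acc s b \<longrightarrow> b \<in> G))}"
  let ?F = "{f. 2 * card {i\<in>{..<R}. f i \<notin> ?B} \<le> R}"
  let ?G = "{f. (SOME b. R < 2 * card {i\<in>{..<R}. acc (f i) b}) \<in> G}"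
  have "- ?F \<subseteq> ?G"
  proof
    fix f assume "f \<in> - ?F"
    then have f: "R < 2 * card {i\<in>{..<R}. f i \<notin> ?B}" by simp
    have "card {i\<in>{..<R}. f i \<notin> ?B} \<le> card {i\<in>{..<R}. acc (f i) a}" by (intro card_mono) auto
    with f have "R < 2 * card {i\<in>{..<R}. acc (f i) a}" by linarith
    then have b: "R < 2 * card {i\<in>{..<R}. acc (f i) (SOME b. R < 2 * card {i\<in>{..<R}. acc (f i) b})}"
      (is "_ < 2 * card ?I") by (rule someI)
    have "{i\<in>{..<R}. f i \<notin> ?B} \<inter> ?I \<noteq> {}"
    proof
      assume "{i\<in>{..<R}. f i \<notin> ?B} \<inter> ?I = {}"
      then have "card {i\<in>{..<R}. f i \<notin> ?B} + card ?I = card ({i\<in>{..<R}. f i \<notin> ?B} \<union> ?I)"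
        by (intro card_Un_disjoint[symmetric]) auto
      also have "\<dots> \<le> card {..<R}" by (intro card_mono) auto
      finally show False using f b by simp
    qed
    then show "f \<in> ?G" by blast
  qed
  then have "measure_pmf.prob ?P (- ?F) \<le> measure_pmf.prob ?P ?G"
    by (intro measure_pmf.finite_measure_mono) auto
  moreover have "measure_pmf.prob ?P (- ?F) = 1 - measure_pmf.prob ?P ?F"
    using measure_pmf.prob_compl[of ?F ?P] by (simp add: Compl_eq_Diff_UNIV)
  ultimately show ?thesis using majority_fails[OF fin bad, where R=R and d=d] by linarith
qed

section \<open>Linear sketches and hash families\<close>


lemma card_word_lists: "card (word_lists (real B) M) = B ^ M" "finite (word_lists (real B) M)"
proof -
  have eq: "word_lists (real B) M = {ws. set ws \<subseteq> {..<B} \<and> length ws = M}"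
    by (auto simp: word_lists_def)
  show "card (word_lists (real B) M) = B ^ M" unfolding eq by (simp add: card_lists_length_eq)
  show "finite (word_lists (real B) M)" unfolding eq by (simp add: finite_lists_length_eq)
qed

lemma word_lists_mono: "W \<le> W' \<Longrightarrow> word_lists W M \<subseteq> word_lists W' M"
  unfolding word_lists_def by fastforce

lemma sum_list_stream_vec:
  assumes "finite V" "fst ` set \<sigma> \<subseteq> V"
  shows "(\<Sum>(v, \<Delta>)\<leftarrow>\<sigma>. c v * \<Delta>) = (\<Sum>v\<in>V. c v * stream_vec \<sigma> v)"
  using assms(2)
proof (induction \<sigma>)
  case (Cons a \<sigma>)
  have "(\<Sum>v\<in>V. c v * stream_vec (a # \<sigma>) v) =
        (\<Sum>v\<in>V. (if fst a = v then c v * snd a else 0) + c v * stream_vec \<sigma> v)"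
    by (intro sum.cong) (auto simp: stream_vec_def case_prod_unfold algebra_simps)
  also have "\<dots> = c (fst a) * snd a + (\<Sum>v\<in>V. c v * stream_vec \<sigma> v)"
    using Cons.prems assms(1) by (simp add: sum.distrib)
  finally show ?case using Cons by (simp add: case_prod_unfold)
qed (simp add: stream_vec_def)

text \<open>The words keep their initial value and the coefficients depend only on them and on the
  item, so the initial words are the only source of randomness.\<close>

lemma run_linear:
  assumes "\<And>v \<Delta> ws cs. step A (v, \<Delta>) (ws, cs) = return_pmf (ws, map (coef ws v) [0..<num_counters A])"
  shows "run A \<sigma> = map_pmf (\<lambda>ws. (ws, map (\<lambda>i. \<Sum>(v, \<Delta>)\<leftarrow>\<sigma>. of_int (coef ws v i) * \<Delta>) [0..<num_counters A])) (init A)"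
proof (induction \<sigma> rule: rev_induct)
  case Nil
  have "replicate n (0::real) = map (\<lambda>i. 0) [0..<n]" for n by (simp add: map_replicate_const)
  then show ?case by (simp add: run_def init_memory_def)
next
  case (snoc a \<sigma>)
  obtain v \<Delta> where a: "a = (v, \<Delta>)" by fastforce
  have upd: "update_memory A (v, \<Delta>) (ws, map f [0..<num_counters A]) =
      return_pmf (ws, map (\<lambda>i. f i + of_int (coef ws v i) * \<Delta>) [0..<num_counters A])" for f ws
    unfolding update_memory_def assms by (auto simp: map_zip_map2[symmetric] zip_map_map case_prod_unfold intro: nth_equalityI)
  have "run A (\<sigma> @ [a]) = bind_pmf (run A \<sigma>) (update_memory A a)" by (simp add: run_def)
  then show ?case unfolding snoc.IH a by (simp add: bind_map_pmf upd) (simp add: map_pmf_def)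
qed

text \<open>Only the number of seeds matters: a random seed is stored in \<open>M\<close> words through an arbitrary
  injection of its support into the word lists.\<close>

lemma linear_sketch:
  fixes D :: "'s pmf" and J :: "'j set" and coef :: "'s \<Rightarrow> nat \<Rightarrow> 'j \<Rightarrow> int"
    and dec :: "'q \<Rightarrow> 's \<Rightarrow> ('j \<Rightarrow> real) \<Rightarrow> 'a pmf"
  assumes D: "finite (set_pmf D)" "card (set_pmf D) \<le> B ^ M" and W: "real B \<le> W"
    and J: "finite J" and coef: "\<And>s v j. coef s v j \<in> {-1, 0, 1}"
  shows "\<exists>A. memory_size A = M + card J \<and> runs_in_memory W A \<and>
           (\<forall>\<sigma> V q. finite V \<longrightarrow> fst ` set \<sigma> \<subseteq> V \<longrightarrow>
              response A \<sigma> q = bind_pmf D (\<lambda>s. dec q s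
                (\<lambda>j. if j \<in> J then \<Sum>v\<in>V. of_int (coef s v j) * stream_vec \<sigma> v else 0)))"
proof -
  obtain e where e: "inj_on e (set_pmf D)" "e ` set_pmf D \<subseteq> word_lists (real B) M"
    using card_le_inj[OF D(1) card_word_lists(2)[of B M]] D(2) card_word_lists(1) by metis
  have eW: "e ` set_pmf D \<subseteq> word_lists W M" using e(2) word_lists_mono[OF W] by blast
  define d where "d = the_inv_into (set_pmf D) e"
  have d: "d (e s) = s" if "s \<in> set_pmf D" for s
    unfolding d_def using e(1) that by (rule the_inv_into_f_f)
  obtain b where b: "bij_betw b {0..<card J} J" using ex_bij_betw_nat_finite[OF J] by blast
  let ?b' = "the_inv_into {0..<card J} b"
  define A :: "('q, 'a) streaming_alg" where "A = \<lparr>num_words = M, num_counters = card J,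
    init = map_pmf e D,
    step = (\<lambda>(v, \<Delta>) (ws, cs). return_pmf (ws, map (\<lambda>i. coef (d ws) v (b i)) [0..<card J])),
    answer = (\<lambda>q (ws, cs). dec q (d ws) (\<lambda>j. if j \<in> J then cs ! ?b' j else 0))\<rparr>"
  have resp: "response A \<sigma> q = bind_pmf D (\<lambda>s. dec q s
                (\<lambda>j. if j \<in> J then \<Sum>v\<in>V. of_int (coef s v j) * stream_vec \<sigma> v else 0))"
    if V: "finite V" "fst ` set \<sigma> \<subseteq> V" for \<sigma> V q
  proof -
    have nc: "num_counters A = card J" by (simp add: A_def)
    have run: "run A \<sigma> = map_pmf (\<lambda>ws. (ws, map (\<lambda>i. \<Sum>(v, \<Delta>)\<leftarrow>\<sigma>. of_int (coef (d ws) v (b i)) * \<Delta>) [0..<card J])) (map_pmf e D)"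
      by (subst run_linear[where coef = "\<lambda>ws v i. coef (d ws) v (b i)"]) (simp_all add: A_def)
    have cs: "(\<lambda>j. if j \<in> J then map (\<lambda>i. \<Sum>(v, \<Delta>)\<leftarrow>\<sigma>. of_int (coef s v (b i)) * \<Delta>) [0..<card J] ! ?b' j else 0)
        = (\<lambda>j. if j \<in> J then \<Sum>v\<in>V. of_int (coef s v j) * stream_vec \<sigma> v else 0)" for s
    proof (rule ext)
      fix j
      show "(if j \<in> J then map (\<lambda>i. \<Sum>(v, \<Delta>)\<leftarrow>\<sigma>. of_int (coef s v (b i)) * \<Delta>) [0..<card J] ! ?b' j else 0)
        = (if j \<in> J then \<Sum>v\<in>V. of_int (coef s v j) * stream_vec \<sigma> v else 0)"
      proof (cases "j \<in> J")
        case True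
        have "b (?b' j) = j" using b True by (simp add: f_the_inv_into_f_bij_betw)
        moreover have "?b' j < card J"
          using the_inv_into_into[of b "{0..<card J}" j "{0..<card J}"] b True
          by (auto simp: bij_betw_def)
        ultimately show ?thesis using True sum_list_stream_vec[OF V, of "\<lambda>v. of_int (coef s v j)"] by simp
      qed simp
    qed
    have "answer A q = (\<lambda>(ws, cs). dec q (d ws) (\<lambda>j. if j \<in> J then cs ! ?b' j else 0))"
      by (simp add: A_def)
    then show ?thesis unfolding response_def run
      by (simp add: bind_map_pmf cs) (intro bind_pmf_cong, simp_all add: d cong: if_cong)
  qed
  \<comment> \<open>Words that encode no seed are decoded arbitrarily by \<open>d\<close>; the
    requirement still holds for them because \<open>coef\<close> is bounded for every seed
    argument.\<close>
  have "runs_in_memory W A"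
    using eW coef unfolding runs_in_memory_def A_def by (auto simp: image_subset_iff)
  moreover have "memory_size A = M + card J" by (simp add: A_def memory_size_def)
  ultimately show ?thesis using resp by blast
qed

section \<open>Pairwise independent bits and universal hashing\<close>

definition pairwise_bits :: "nat \<Rightarrow> (nat \<Rightarrow> bool) pmf \<Rightarrow> bool" where
  "pairwise_bits N P \<longleftrightarrow> finite (set_pmf P) \<and> card (set_pmf P) \<le> N \<and>
     (\<forall>u<N. \<forall>v<N. u \<noteq> v \<longrightarrow> measure_pmf.prob P {f. f u = f v} = 1/2)"

definition universal_hash :: "nat \<Rightarrow> nat \<Rightarrow> (nat \<Rightarrow> nat) pmf \<Rightarrow> bool" where
  "universal_hash N k P \<longleftrightarrow> finite (set_pmf P) \<and> card (set_pmf P) \<le> N ^ k \<and>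
     (\<forall>g\<in>set_pmf P. \<forall>u. g u < 2 ^ k) \<and>
     (\<forall>u<N. \<forall>v<N. u \<noteq> v \<longrightarrow> measure_pmf.prob P {g. g u = g v} = 1 / 2 ^ k)"

lemma card_set_map_pair_le:
  assumes "finite (set_pmf p)" "finite (set_pmf q)" "card (set_pmf p) \<le> a" "card (set_pmf q) \<le> b"
  shows "finite (set_pmf (map_pmf F (pair_pmf p q)))" "card (set_pmf (map_pmf F (pair_pmf p q))) \<le> a * b"
proof -
  show "finite (set_pmf (map_pmf F (pair_pmf p q)))" using assms by simp
  have "card (set_pmf (map_pmf F (pair_pmf p q))) \<le> card (set_pmf p \<times> set_pmf q)"
    using assms(1,2) card_image_le[of "set_pmf p \<times> set_pmf q" F] by simp
  also have "\<dots> \<le> a * b" using assms by (simp add: card_cartesian_product mult_mono)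
  finally show "card (set_pmf (map_pmf F (pair_pmf p q))) \<le> a * b" .
qed

text \<open>The functions are the inner products over GF(2) of the binary digits of \<open>v\<close>
  with a random bit vector, built digit by digit. Arguments that agree after halving differ in the
  last digit and collide only if its coefficient \<open>c\<close> is 0; otherwise the induction
  hypothesis gives 1/2 for either value of \<open>c\<close>.\<close>

lemma pairwise_bits_exist: "\<exists>P. pairwise_bits (2 ^ L) P"
proof (induction L)
  case 0
  show ?case by (intro exI[of _ "return_pmf (\<lambda>_. False)"]) (simp add: pairwise_bits_def)
next
  case (Suc L)
  then obtain P where P: "pairwise_bits (2 ^ L) P" by blast
  define F where "F = (\<lambda>(c::bool, f) v::nat. f (v div 2) \<noteq> (c \<and> odd v))"
  let ?C = "pmf_of_set (UNIV :: bool set)"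
  define Q where "Q = map_pmf F (pair_pmf ?C P)"
  have fin: "finite (set_pmf P)" using P by (simp add: pairwise_bits_def)
  have "measure_pmf.prob Q {f. f u = f v} = 1/2" if uv: "u < 2 ^ Suc L" "v < 2 ^ Suc L" "u \<noteq> v" for u v
  proof -
    have "measure_pmf.prob Q {f. f u = f v} =
       pexp ?C (\<lambda>c. measure_pmf.prob P {f. F (c, f) u = F (c, f) v})"
      unfolding Q_def using fin prob_pair[of ?C P "\<lambda>c f. F (c, f) u = F (c, f) v"] by (simp add: vimage_def)
    also have "\<dots> = (measure_pmf.prob P {f. F (True, f) u = F (True, f) v} +
                     measure_pmf.prob P {f. F (False, f) u = F (False, f) v}) / 2"
      by (subst integral_pmf_of_set) (auto simp: UNIV_bool)
    also have "\<dots> = 1/2"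
    proof (cases "u div 2 = v div 2")
      case True
      then have "odd u \<noteq> odd v" using uv(3) by (metis div_mult_mod_eq odd_iff_mod_2_eq_one even_iff_mod_2_eq_zero)
      then have "{f. F (True, f) u = F (True, f) v} = {}" "{f. F (False, f) u = F (False, f) v} = UNIV"
        using True by (auto simp: F_def)
      then show ?thesis by simp
    next
      case False
      moreover have "u div 2 < 2 ^ L" "v div 2 < 2 ^ L" using uv by auto
      ultimately have half: "measure_pmf.prob P {f. f (u div 2) = f (v div 2)} = 1/2"
        using P by (simp add: pairwise_bits_def)
      have "{f :: nat \<Rightarrow> bool. f (u div 2) \<noteq> f (v div 2)} = space (measure_pmf P) - {f. f (u div 2) = f (v div 2)}"
        by auto
      then have half': "measure_pmf.prob P {f. f (u div 2) \<noteq> f (v div 2)} = 1/2"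
        using measure_pmf.prob_compl[of "{f. f (u div 2) = f (v div 2)}" P] half by simp
      have "{f. F (True, f) u = F (True, f) v} = (if odd u = odd v then {f. f (u div 2) = f (v div 2)} else {f. f (u div 2) \<noteq> f (v div 2)})"
        by (auto simp: F_def)
      with half half' show ?thesis by (simp add: F_def)
    qed
    finally show ?thesis .
  qed
  moreover have "finite (set_pmf Q)" "card (set_pmf Q) \<le> 2 * 2 ^ L"
    unfolding Q_def using card_set_map_pair_le[of ?C P 2 "2 ^ L" F] P by (auto simp: pairwise_bits_def)
  ultimately show ?case by (intro exI[of _ Q]) (simp add: pairwise_bits_def)
qed

text \<open>A hash value is the binary number formed by \<open>k\<close> independent bits, and two
  values agree only if all bits do. The seed count multiplies by \<open>N\<close> per bit.\<close>

lemma universal_hash_exist: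
  assumes "pairwise_bits N P"
  shows "\<exists>H. universal_hash N k H"
proof (induction k)
  case 0
  show ?case by (intro exI[of _ "return_pmf (\<lambda>_. 0)"]) (simp add: universal_hash_def)
next
  case (Suc k)
  then obtain H where H: "universal_hash N k H" by blast
  define F where "F = (\<lambda>(g::nat \<Rightarrow> nat, f::nat \<Rightarrow> bool) v. 2 * g v + of_bool (f v))"
  define Q where "Q = map_pmf F (pair_pmf H P)"
  have fin: "finite (set_pmf P)" "finite (set_pmf H)" using assms H by (simp_all add: pairwise_bits_def universal_hash_def)
  have eq: "F (g, f) u = F (g, f) v \<longleftrightarrow> g u = g v \<and> f u = f v" for f g u v
  proof -
    have "2 * a + of_bool c = 2 * b + of_bool d \<longleftrightarrow> a = b \<and> c = d" for a b :: nat and c d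
      by (cases c; cases d; simp; presburger)
    then show ?thesis by (simp add: F_def)
  qed
  have "measure_pmf.prob Q {g. g u = g v} = 1 / 2 ^ Suc k" if uv: "u < N" "v < N" "u \<noteq> v" for u v
  proof -
    have "measure_pmf.prob Q {g. g u = g v} =
       pexp H (\<lambda>g. measure_pmf.prob P {f. g u = g v \<and> f u = f v})"
      unfolding Q_def using fin prob_pair[of H P "\<lambda>g f. F (g, f) u = F (g, f) v"] by (simp add: vimage_def eq)
    also have "\<dots> = pexp H (\<lambda>g. indicat_real {g. g u = g v} g * (1/2))"
    proof (intro pexp_cong)
      fix g
      show "measure_pmf.prob P {f. g u = g v \<and> f u = f v} = indicat_real {g. g u = g v} g * (1/2)"
        using assms uv by (cases "g u = g v") (auto simp: pairwise_bits_def)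
    qed
    also have "\<dots> = measure_pmf.prob H {g. g u = g v} / 2" by simp
    finally show ?thesis using H uv by (simp add: universal_hash_def)
  qed
  moreover have "finite (set_pmf Q)" "card (set_pmf Q) \<le> N ^ k * N"
    unfolding Q_def using card_set_map_pair_le[of H P "N ^ k" N F] assms H
    by (auto simp: pairwise_bits_def universal_hash_def)
  moreover have "g u < 2 ^ Suc k" if g': "g \<in> set_pmf Q" for g u
  proof -
    obtain h f where g: "g = F (h, f)" "h \<in> set_pmf H" using g' by (auto simp: Q_def)
    then have "h u < 2 ^ k" using H by (simp add: universal_hash_def)
    then show ?thesis by (auto simp: g F_def)
  qed
  ultimately show ?case by (intro exI[of _ Q]) (simp add: universal_hash_def mult.commute)
qed

section \<open>Heavy dyadic blocks and the two-stage estimate\<close>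


definition sg :: "bool \<Rightarrow> real" where "sg b = (if b then 1 else - 1)"

lemma sg_square [simp]: "sg b * sg b = 1" "sg b * (sg b * c) = c"
  by (auto simp: sg_def)

text \<open>A product of two signs is twice the collision indicator minus 1, so collision
  probability 1/2 is all the independence that signs have to provide.\<close>

lemma sign_correlation:
  assumes "pairwise_bits N B" "u < N" "v < N"
  shows "pexp B (\<lambda>s. sg (s u) * sg (s v)) = of_bool (u = v)"
proof (cases "u = v")
  case False
  have fin: "finite (set_pmf B)" using assms(1) by (simp add: pairwise_bits_def)
  have "pexp B (\<lambda>s. sg (s u) * sg (s v)) = pexp B (\<lambda>s. 2 * indicat_real {f. f u = f v} s + (- 1))"
    by (intro pexp_cong) (auto simp: sg_def)
  also have "\<dots> = 2 * measure_pmf.prob B {f. f u = f v} - 1"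
    by (subst pexp_add[OF fin]) simp
  also have "measure_pmf.prob B {f. f u = f v} = 1/2" using assms False unfolding pairwise_bits_def by blast
  finally show ?thesis using False by simp
qed simp

lemma collision_prob:
  assumes "universal_hash N k H" "u < N" "v < N" "u \<noteq> v"
  shows "pexp H (\<lambda>g. of_bool (g u = g v)) = 1 / 2 ^ k"
proof -
  have "pexp H (\<lambda>g. of_bool (g u = g v)) = measure_pmf.prob H {g. g u = g v}"
    unfolding prob_eq_pexp by (intro pexp_cong) auto
  then show ?thesis using assms by (simp add: universal_hash_def)
qed

text \<open>The excess of the Count-Min counter of \<open>p\<close> over the true weight of
  \<open>p\<close>.\<close>

definition colliding :: "nat set \<Rightarrow> (nat \<Rightarrow> real) \<Rightarrow> nat \<Rightarrow> (nat \<Rightarrow> nat) \<Rightarrow> real" where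
  "colliding P X p g = (\<Sum>r\<in>P - {p}. of_bool (g r = g p) * X r)"

lemma colliding_nonneg: "(\<And>r. r \<in> P \<Longrightarrow> X r \<ge> 0) \<Longrightarrow> colliding P X p g \<ge> 0"
  unfolding colliding_def by (intro sum_nonneg) auto

lemma expected_colliding:
  assumes H: "universal_hash N k H" and P: "P \<subseteq> {..<N}" "p \<in> P" and X: "\<And>r. r \<in> P \<Longrightarrow> X r \<ge> 0"
  shows "pexp H (colliding P X p) \<le> sum X P / 2 ^ k"
proof -
  have fin: "finite (set_pmf H)" "finite P" using H P finite_subset by (auto simp: universal_hash_def)
  have "pexp H (colliding P X p) = (\<Sum>r\<in>P - {p}. pexp H (\<lambda>g. of_bool (g r = g p)) * X r)"
    unfolding colliding_def by (subst pexp_sum[OF fin(1)]) simp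
  also have "\<dots> = (\<Sum>r\<in>P - {p}. X r / 2 ^ k)"
    using P by (intro sum.cong refl, subst collision_prob[OF H]) auto
  also have "\<dots> \<le> (\<Sum>r\<in>P. X r / 2 ^ k)" using fin X by (intro sum_mono2) auto
  finally show ?thesis by (simp add: sum_divide_distrib)
qed

text \<open>The bucket of \<open>p\<close> multiplied by the sign of \<open>p\<close> equals
  \<open>y p\<close> plus this error.\<close>

definition sketch_error :: "nat set \<Rightarrow> (nat \<Rightarrow> real) \<Rightarrow> nat \<Rightarrow> (nat \<Rightarrow> nat) \<times> (nat \<Rightarrow> bool) \<Rightarrow> real" where
  "sketch_error P y p = (\<lambda>(g, s). \<Sum>r\<in>P - {p}. of_bool (g r = g p) * y r * (sg (s p) * sg (s r)))"

text \<open>For every fixed hash function the signs are uncorrelated. Hence the mean vanishes, and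
  in the square only the diagonal terms survive, each weighted by its collision probability
  \<open>1 / 2 ^ k\<close>.\<close>

lemma sketch_error:
  assumes H: "universal_hash N k H" and B: "pairwise_bits N B" and P: "P \<subseteq> {..<N}" "p \<in> P"
  shows "pexp (pair_pmf H B) (sketch_error P y p) = 0"
    and "pexp (pair_pmf H B) (\<lambda>z. (sketch_error P y p z)\<^sup>2) \<le> (\<Sum>r\<in>P. (y r)\<^sup>2) / 2 ^ k"
proof -
  have fin: "finite (set_pmf H)" "finite (set_pmf B)" "finite P"
    using H B P finite_subset by (auto simp: universal_hash_def pairwise_bits_def)
  have "pexp (pair_pmf H B) (sketch_error P y p) =
      pexp H (\<lambda>g. \<Sum>r\<in>P - {p}. of_bool (g r = g p) * y r * pexp B (\<lambda>s. sg (s p) * sg (s r)))"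
    by (subst pexp_pair[OF fin(1,2)]) (simp add: sketch_error_def pexp_sum[OF fin(2)])
  also have "\<dots> = pexp H (\<lambda>g. 0)"
    using P by (intro pexp_cong sum.neutral) (auto simp: sign_correlation[OF B] subset_iff)
  finally show "pexp (pair_pmf H B) (sketch_error P y p) = 0" by simp
  have sq: "(sketch_error P y p (g, s))\<^sup>2 =
     (\<Sum>r\<in>P - {p}. \<Sum>r'\<in>P - {p}. of_bool (g r = g p) * of_bool (g r' = g p) * y r * y r' * (sg (s r) * sg (s r')))" for g s
    unfolding sketch_error_def power2_eq_square prod.case sum_product
    by (intro sum.cong refl) (simp add: mult_ac del: of_bool_eq_iff)
  have "pexp (pair_pmf H B) (\<lambda>z. (sketch_error P y p z)\<^sup>2) =
      pexp H (\<lambda>g. \<Sum>r\<in>P - {p}. \<Sum>r'\<in>P - {p}. of_bool (g r = g p) * of_bool (g r' = g p) * y r * y r' *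
         pexp B (\<lambda>s. sg (s r) * sg (s r')))"
    by (subst pexp_pair[OF fin(1,2)]) (simp add: sq pexp_sum[OF fin(2)])
  also have "\<dots> = pexp H (\<lambda>g. \<Sum>r\<in>P - {p}. of_bool (g r = g p) * (y r)\<^sup>2)"
  proof (intro pexp_cong sum.cong refl)
    fix g r assume r: "r \<in> P - {p}"
    have "(\<Sum>r'\<in>P - {p}. of_bool (g r = g p) * of_bool (g r' = g p) * y r * y r' * pexp B (\<lambda>s. sg (s r) * sg (s r'))) =
          (\<Sum>r'\<in>P - {p}. if r' = r then of_bool (g r = g p) * (y r)\<^sup>2 else 0)"
      using P r by (intro sum.cong refl) (auto simp: sign_correlation[OF B] subset_iff power2_eq_square)
    then show "(\<Sum>r'\<in>P - {p}. of_bool (g r = g p) * of_bool (g r' = g p) * y r * y r' * pexp B (\<lambda>s. sg (s r) * sg (s r'))) =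
       of_bool (g r = g p) * (y r)\<^sup>2" using fin r by simp
  qed
  also have "\<dots> = (\<Sum>r\<in>P - {p}. pexp H (\<lambda>g. of_bool (g r = g p)) * (y r)\<^sup>2)"
    by (subst pexp_sum[OF fin(1)]) simp
  also have "\<dots> = (\<Sum>r\<in>P - {p}. (y r)\<^sup>2 / 2 ^ k)"
    using P by (intro sum.cong refl, subst collision_prob[OF H]) auto
  also have "\<dots> \<le> (\<Sum>r\<in>P. (y r)\<^sup>2 / 2 ^ k)" using fin by (intro sum_mono2) auto
  finally show "pexp (pair_pmf H B) (\<lambda>z. (sketch_error P y p z)\<^sup>2) \<le> (\<Sum>r\<in>P. (y r)\<^sup>2) / 2 ^ k"
    by (simp add: sum_divide_distrib)
qed

text \<open>\<open>p div 2 ^ (i - h)\<close> is the ancestor of \<open>p\<close> at level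
  \<open>i\<close>. The root, at level \<open>L\<close>, is heavy by convention, since tables exist
  only below it.\<close>

definition heavy :: "nat \<Rightarrow> real \<Rightarrow> (nat \<Rightarrow> nat \<Rightarrow> real) \<Rightarrow> nat \<Rightarrow> nat \<Rightarrow> bool" where
  "heavy L \<tau> m h p \<longleftrightarrow> (\<forall>i\<in>{h..<L}. \<tau> < m i (p div 2 ^ (i - h)))"

definition guess :: "nat \<Rightarrow> real \<Rightarrow> (nat \<Rightarrow> nat \<Rightarrow> real) \<Rightarrow> nat \<Rightarrow> nat \<Rightarrow> real" where
  "guess L \<tau> m h p = (if heavy L \<tau> m h p then m h p else 0)"

lemma heavy_step:
  assumes "h < L"
  shows "heavy L \<tau> m h p \<longleftrightarrow> \<tau> < m h p \<and> heavy L \<tau> m (Suc h) (p div 2)"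
proof -
  have "{h..<L} = insert h {Suc h..<L}" using assms by auto
  moreover have "p div 2 ^ (i - h) = p div 2 div 2 ^ (i - Suc h)" if "Suc h \<le> i" for i
  proof -
    have "i - h = Suc (i - Suc h)" using that by simp
    then show ?thesis by (simp add: div_mult2_eq)
  qed
  ultimately show ?thesis unfolding heavy_def by auto
qed

lemma heavy_cong:
  assumes "\<And>i. h \<le> i \<Longrightarrow> i < L \<Longrightarrow> m i (p div 2 ^ (i - h)) = m' i (p div 2 ^ (i - h))"
  shows "heavy L \<tau> m h p = heavy L \<tau> m' h p"
  unfolding heavy_def using assms by auto

definition mass :: "nat \<Rightarrow> (nat \<Rightarrow> real) \<Rightarrow> nat \<Rightarrow> nat \<Rightarrow> real" where
  "mass L x h p = (\<Sum>v | v < 2 ^ L \<and> v div 2 ^ h = p. x v)"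

lemma sum_mass:
  assumes "h \<le> L"
  shows "(\<Sum>p<2 ^ (L - h). c p * mass L x h p) = (\<Sum>v<2 ^ L. c (v div 2 ^ h) * x v)"
proof -
  have img: "(\<lambda>v. v div 2 ^ h) ` {..<2 ^ L} \<subseteq> {..<2 ^ (L - h) :: nat}"
    using assms by (auto simp: less_mult_imp_div_less power_add[symmetric])
  have "(\<Sum>v<2 ^ L. c (v div 2 ^ h) * x v) =
     (\<Sum>p<2 ^ (L - h). \<Sum>v\<in>{v\<in>{..<2 ^ L}. v div 2 ^ h = p}. c (v div 2 ^ h) * x v)"
    by (subst sum.group[OF _ _ img]) auto
  also have "\<dots> = (\<Sum>p<2 ^ (L - h). c p * mass L x h p)"
    unfolding mass_def sum_distrib_left by (intro sum.cong refl) auto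
  finally show ?thesis by simp
qed

text \<open>The form used in the analysis: weight plus the smaller of two independent excesses.
  \<open>read_count_min\<close> recovers this number from the counters.\<close>

definition count_min :: "nat \<Rightarrow> (nat \<Rightarrow> real) \<Rightarrow> (nat \<Rightarrow> (nat \<Rightarrow> nat) \<times> (nat \<Rightarrow> nat)) \<Rightarrow> nat \<Rightarrow> nat \<Rightarrow> real" where
  "count_min L x f h p = mass L x h p +
     min (colliding {..<2 ^ (L - h)} (mass L x h) p (fst (f h)))
         (colliding {..<2 ^ (L - h)} (mass L x h) p (snd (f h)))"

section \<open>Weights of the dyadic blocks of a nonnegative vector\<close>

locale dyadic =
  fixes L :: nat and x :: "nat \<Rightarrow> real"
  assumes x_nonneg: "\<And>v. x v \<ge> 0"
begin

abbreviation "X \<equiv> mass L x"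
abbreviation "blocks h \<equiv> {..<(2::nat) ^ (L - h)}"

definition S :: real where "S = (\<Sum>v<2 ^ L. x v)"

lemma X_nonneg: "X h p \<ge> 0"
  unfolding mass_def by (intro sum_nonneg) (auto simp: x_nonneg)

lemma sum_X: "h \<le> L \<Longrightarrow> sum (X h) (blocks h) = S"
  using sum_mass[of h L "\<lambda>_. 1" x] by (simp add: S_def)

lemma S_nonneg: "S \<ge> 0" unfolding S_def by (intro sum_nonneg) (auto simp: x_nonneg)

lemma blocks_subset: "blocks h \<subseteq> {..<2 ^ L}"
  by (auto intro: order_less_le_trans power_increasing)

lemma X_mono: "h \<le> i \<Longrightarrow> X h p \<le> X i (p div 2 ^ (i - h))"
  unfolding mass_def by (intro sum_mono2) (auto simp: x_nonneg div_mult2_eq[symmetric] power_add[symmetric])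

end

section \<open>Surviving blocks and the size of the residual\<close>

definition row_seeds1 :: "nat \<Rightarrow> (nat \<Rightarrow> nat) pmf \<Rightarrow> (nat \<Rightarrow> (nat \<Rightarrow> nat) \<times> (nat \<Rightarrow> nat)) pmf" where
  "row_seeds1 L H = Pi_pmf {..<L} ((\<lambda>_. 0), (\<lambda>_. 0)) (\<lambda>_. pair_pmf H H)"

definition row_seeds2 :: "nat \<Rightarrow> (nat \<Rightarrow> nat) pmf \<Rightarrow> (nat \<Rightarrow> bool) pmf \<Rightarrow> (nat \<Rightarrow> (nat \<Rightarrow> nat) \<times> (nat \<Rightarrow> bool)) pmf" where
  "row_seeds2 L H B = Pi_pmf {..<L} ((\<lambda>_. 0), (\<lambda>_. False)) (\<lambda>_. pair_pmf H B)"

locale dyadic_sketch = dyadic L x for L x +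
  fixes k :: nat and H :: "(nat \<Rightarrow> nat) pmf" and B :: "(nat \<Rightarrow> bool) pmf"
  assumes k_pos: "k > 0" and H: "universal_hash (2 ^ L) k H" and B: "pairwise_bits (2 ^ L) B"
begin

abbreviation "w \<equiv> (2::real) ^ k"
abbreviation "F1 \<equiv> row_seeds1 L H"
abbreviation "F2 \<equiv> row_seeds2 L H B"

text \<open>Half of this threshold is four times the bound \<open>S / w\<close> on the expected
  excess, so Markov's inequality gives 1/4 for an excess that large. Two children per survivor then
  contract the count by 1/2 per level.\<close>

definition \<tau> :: real where "\<tau> = 8 * S / w"

abbreviation "heavy_at f \<equiv> heavy L \<tau> (count_min L x f)"
abbreviation "heavy_parent f h \<equiv> {p\<in>blocks h. heavy_at f (Suc h) (p div 2)}"
definition resid where "resid f h p = X h p - guess L \<tau> (count_min L x f) h p"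

lemma finH: "finite (set_pmf H)" and finB: "finite (set_pmf B)"
  using H B by (simp_all add: universal_hash_def pairwise_bits_def)

lemma finHH: "finite (set_pmf (pair_pmf H H))" and finHB: "finite (set_pmf (pair_pmf H B))"
  using finH finB by simp_all

lemma finF1: "finite (set_pmf F1)" and finF2: "finite (set_pmf F2)"
  unfolding row_seeds1_def row_seeds2_def using finHH finHB by (auto intro!: finite_set_Pi_pmf)

lemma colliding_X_nonneg: "colliding (blocks h) (X h) p g \<ge> 0"
  by (intro colliding_nonneg X_nonneg)

lemma expected_colliding_X:
  assumes "h \<le> L" "p \<in> blocks h"
  shows "pexp H (colliding (blocks h) (X h) p) \<le> S / w"
  using expected_colliding[OF H blocks_subset assms(2), of "X h"] by (simp add: X_nonneg sum_X[OF assms(1)])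

lemma X_le_count_min: "X h p \<le> count_min L x f h p"
  unfolding count_min_def using colliding_X_nonneg by simp

text \<open>The block itself or some ancestor has an estimate of at most \<open>\<tau>\<close>.
  Count-Min never underestimates, and an ancestor weighs at least as much as
  \<open>p\<close>.\<close>

lemma X_le_threshold:
  assumes "\<not> heavy_at f h p"
  shows "X h p \<le> \<tau>"
proof -
  obtain i where "h \<le> i" "count_min L x f i (p div 2 ^ (i - h)) \<le> \<tau>"
    using assms by (auto simp: heavy_def not_less)
  then show ?thesis using X_mono[of h i p] X_le_count_min[of i "p div 2 ^ (i - h)" f] by linarith
qed

text \<open>Survival above level \<open>h\<close> is decided by the seeds of the higher levels
  alone, so it is fixed while the seeds of level \<open>h\<close> are redrawn.\<close>

lemma heavy_upd: "heavy_at (f(h := y)) (Suc h) p = heavy_at f (Suc h) p"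
  by (intro heavy_cong) (simp add: count_min_def)

lemma card_heavy_parent:
  assumes "h < L"
  shows "card (heavy_parent f h) \<le> 2 * card {p\<in>blocks (Suc h). heavy_at f (Suc h) p}"
proof -
  let ?T = "{p\<in>blocks (Suc h). heavy_at f (Suc h) p} \<times> {..<2::nat}"
  have "inj_on (\<lambda>p. (p div 2, p mod 2)) (heavy_parent f h)"
    by (intro inj_onI) (metis div_mult_mod_eq fst_conv snd_conv)
  moreover have "p div 2 < 2 ^ (L - Suc h)" if "p < 2 ^ (L - h)" for p :: nat
  proof -
    have "L - h = Suc (L - Suc h)" using assms by simp
    with that have "p < 2 ^ (L - Suc h) * 2" by simp
    then show ?thesis by (rule less_mult_imp_div_less)
  qed
  then have "(\<lambda>p. (p div 2, p mod 2)) ` heavy_parent f h \<subseteq> ?T" by auto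
  ultimately have "card (heavy_parent f h) \<le> card ?T" by (intro card_inj_on_le) auto
  then show ?thesis by (simp add: card_cartesian_product)
qed

lemma card_large:
  assumes "S > 0" "h \<le> L"
  shows "real (card {p\<in>blocks h. \<tau> / 2 < X h p}) \<le> w / 4"
proof -
  let ?A = "{p\<in>blocks h. \<tau> / 2 < X h p}"
  have "real (card ?A) * (\<tau> / 2) = (\<Sum>p\<in>?A. \<tau> / 2)" by simp
  also have "\<dots> \<le> sum (X h) ?A" by (intro sum_mono) auto
  also have "\<dots> \<le> sum (X h) (blocks h)" by (intro sum_mono2) (auto simp: X_nonneg)
  also have "\<dots> = S" by (rule sum_X[OF assms(2)])
  finally show ?thesis using assms(1) by (simp add: \<tau>_def field_simps)
qed

lemma pexp_F1_resample:
  assumes "h < L"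
  shows "pexp F1 \<Phi> = pexp F1 (\<lambda>f. pexp (pair_pmf H H) (\<lambda>y. \<Phi> (f(h := y))))"
  unfolding row_seeds1_def using assms finHH by (intro pexp_Pi_resample) auto

text \<open>A survivor either weighs more than \<open>\<tau> / 2\<close>, which holds for at most
  \<open>w / 4\<close> blocks, or is a child of a survivor and has excess at least
  \<open>\<tau> / 2\<close> in the first table, which has probability at most 1/4. So the expected
  count \<open>E\<close> of one level gives at most \<open>w / 4 + E / 2\<close> for the next, and
  \<open>w / 2\<close> is the fixed point.\<close>

lemma expected_heavy:
  assumes S: "S > 0" and "h \<le> L"
  shows "pexp F1 (\<lambda>f. real (card {p\<in>blocks h. heavy_at f h p})) \<le> w / 2"
  using assms(2)
proof (induction h rule: inc_induct)
  case base
  \<comment> \<open>Level \<open>L\<close> has the root as its only block, so the claim there is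
    \<open>1 \<le> w / 2\<close>, which is where \<open>k > 0\<close> enters.\<close>
  have "(2::real) ^ 1 \<le> w" using k_pos by (intro power_increasing) auto
  moreover have "{p\<in>blocks L. heavy_at f L p} = {0}" for f by (auto simp: heavy_def)
  ultimately show ?case by simp
next
  case (step h)
  have "pexp (pair_pmf H H) (\<lambda>y. real (card {p\<in>blocks h. heavy_at (f(h := y)) h p}))
        \<le> w / 4 + real (card {p\<in>blocks (Suc h). heavy_at f (Suc h) p}) / 2" for f
  proof -
    let ?Q = "heavy_parent f h" and ?Z = "\<lambda>p g. colliding (blocks h) (X h) p g"
    have "real (card {p\<in>blocks h. heavy_at (f(h := y)) h p})
          \<le> w / 4 + (\<Sum>p\<in>?Q. indicat_real {g. \<tau> / 2 \<le> ?Z p g} (fst y))" for y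
    proof -
      have "p \<in> {p\<in>blocks h. \<tau> / 2 < X h p} \<union> {p\<in>?Q. \<tau> / 2 \<le> ?Z p (fst y)}"
        if "p \<in> blocks h" "heavy_at (f(h := y)) h p" for p
      proof -
        have "\<tau> < X h p + min (?Z p (fst y)) (?Z p (snd y))" "p \<in> ?Q"
          using that step(2) by (auto simp: heavy_step heavy_upd count_min_def)
        then show ?thesis using that by (auto simp: not_less)
      qed
      then have "{p\<in>blocks h. heavy_at (f(h := y)) h p} \<subseteq>
          {p\<in>blocks h. \<tau> / 2 < X h p} \<union> {p\<in>?Q. \<tau> / 2 \<le> ?Z p (fst y)}"
        by blast
      then have "card {p\<in>blocks h. heavy_at (f(h := y)) h p} \<le>
          card ({p\<in>blocks h. \<tau> / 2 < X h p} \<union> {p\<in>?Q. \<tau> / 2 \<le> ?Z p (fst y)})"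
        by (intro card_mono) simp_all
      also have "\<dots> \<le> card {p\<in>blocks h. \<tau> / 2 < X h p} + card {p\<in>?Q. \<tau> / 2 \<le> ?Z p (fst y)}"
        by (rule card_Un_le)
      finally have "real (card {p\<in>blocks h. heavy_at (f(h := y)) h p}) \<le>
          real (card {p\<in>blocks h. \<tau> / 2 < X h p}) + real (card {p\<in>?Q. \<tau> / 2 \<le> ?Z p (fst y)})"
        by linarith
      moreover have "real (card {p\<in>?Q. \<tau> / 2 \<le> ?Z p (fst y)}) =
          (\<Sum>p\<in>?Q. indicat_real {g. \<tau> / 2 \<le> ?Z p g} (fst y))"
        by (simp add: indicator_def of_bool_def sum.If_cases Int_def)
      ultimately show ?thesis using card_large[OF S, of h] step(2) by linarith
    qed
    then have "pexp (pair_pmf H H) (\<lambda>y. real (card {p\<in>blocks h. heavy_at (f(h := y)) h p})) \<le>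
        pexp (pair_pmf H H) (\<lambda>y. w / 4 + (\<Sum>p\<in>?Q. indicat_real {g. \<tau> / 2 \<le> ?Z p g} (fst y)))"
      by (intro pexp_mono[OF finHH])
    also have "\<dots> = w / 4 + (\<Sum>p\<in>?Q. measure_pmf.prob H {g. \<tau> / 2 \<le> ?Z p g})"
      by (subst pexp_add[OF finHH], subst pexp_sum[OF finHH])
         (simp add: expectation_pair_pmf_fst[where f = "indicat_real A" for A] del: integral_indicator)
    also have "\<dots> \<le> w / 4 + (\<Sum>p\<in>?Q. 1 / 4)"
    proof (intro add_left_mono sum_mono)
      fix p assume p: "p \<in> ?Q"
      have "measure_pmf.prob H {g. \<tau> / 2 \<le> ?Z p g} \<le> pexp H (?Z p) / (\<tau> / 2)"
        using S by (intro markov_pmf[OF finH]) (auto simp: colliding_X_nonneg \<tau>_def)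
      also have "\<dots> \<le> (S / w) / (\<tau> / 2)"
        using expected_colliding_X[of h p] p step(2) S by (intro divide_right_mono) (auto simp: \<tau>_def)
      also have "\<dots> = 1 / 4" using S by (simp add: \<tau>_def)
      finally show "measure_pmf.prob H {g. \<tau> / 2 \<le> ?Z p g} \<le> 1 / 4" .
    qed
    also have "\<dots> \<le> w / 4 + real (card {p\<in>blocks (Suc h). heavy_at f (Suc h) p}) / 2"
      using card_heavy_parent[OF step(2), of f] by simp
    finally show ?thesis .
  qed
  then have "pexp F1 (\<lambda>f. real (card {p\<in>blocks h. heavy_at f h p})) \<le>
     pexp F1 (\<lambda>f. w / 4 + real (card {p\<in>blocks (Suc h). heavy_at f (Suc h) p}) / 2)"
    by (subst pexp_F1_resample[OF step(2)]) (intro pexp_mono[OF finF1])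
  also have "\<dots> = w / 4 + pexp F1 (\<lambda>f. real (card {p\<in>blocks (Suc h). heavy_at f (Suc h) p})) / 2"
    by (subst pexp_add[OF finF1]) simp
  also have "\<dots> \<le> w / 2" using step.IH by simp
  finally show ?case .
qed

text \<open>A light block keeps its whole weight, at most \<open>\<tau>\<close>, so the squares of
  light blocks sum to at most \<open>\<tau> * S = 8 * S\<^sup>2 / w\<close>. A heavy block keeps the
  minimum of two independent excesses; its square is at most their product, whose mean is bounded by
  \<open>(S / w)\<^sup>2\<close> from first moments alone. This is the reason for two Count-Min
  tables. At most \<open>w\<close> children of survivors are expected, which adds
  \<open>S\<^sup>2 / w\<close>.\<close>

lemma expected_resid:
  assumes S: "S > 0" and h: "h < L"
  shows "pexp F1 (\<lambda>f. \<Sum>p\<in>blocks h. (resid f h p)\<^sup>2) \<le> 9 * S\<^sup>2 / w"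
proof -
  have inner: "pexp (pair_pmf H H) (\<lambda>y. \<Sum>p\<in>blocks h. (resid (f(h := y)) h p)\<^sup>2)
        \<le> 8 * S\<^sup>2 / w + real (card {p\<in>blocks (Suc h). heavy_at f (Suc h) p}) * (2 * (S / w)\<^sup>2)" for f
  proof -
    let ?Q = "heavy_parent f h" and ?Z = "\<lambda>p g. colliding (blocks h) (X h) p g"
    have "(\<Sum>p\<in>blocks h. (resid (f(h := y)) h p)\<^sup>2) \<le> 8 * S\<^sup>2 / w + (\<Sum>p\<in>?Q. ?Z p (fst y) * ?Z p (snd y))" for y
    proof -
      have "(resid (f(h := y)) h p)\<^sup>2 \<le> \<tau> * X h p + (if p \<in> ?Q then ?Z p (fst y) * ?Z p (snd y) else 0)"
        if p: "p \<in> blocks h" for p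
      proof (cases "heavy_at (f(h := y)) h p")
        case True
        then have "p \<in> ?Q" using h p by (simp add: heavy_step heavy_upd)
        moreover have "(min (?Z p (fst y)) (?Z p (snd y)))\<^sup>2 \<le> ?Z p (fst y) * ?Z p (snd y)"
          unfolding power2_eq_square by (intro mult_mono) (auto simp: colliding_X_nonneg)
        moreover have "\<tau> * X h p \<ge> 0" using S_nonneg X_nonneg by (simp add: \<tau>_def)
        ultimately show ?thesis using True by (simp add: resid_def guess_def count_min_def)
      next
        case False
        then have "(resid (f(h := y)) h p)\<^sup>2 = X h p * X h p" by (simp add: resid_def guess_def power2_eq_square)
        also have "\<dots> \<le> \<tau> * X h p" using X_le_threshold[OF False] X_nonneg by (intro mult_right_mono) auto
        finally show ?thesis
          using mult_nonneg_nonneg[OF colliding_X_nonneg[of h p "fst y"] colliding_X_nonneg[of h p "snd y"]] by auto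
      qed
      then have "(\<Sum>p\<in>blocks h. (resid (f(h := y)) h p)\<^sup>2) \<le>
         (\<Sum>p\<in>blocks h. \<tau> * X h p + (if p \<in> ?Q then ?Z p (fst y) * ?Z p (snd y) else 0))"
        by (rule sum_mono)
      also have "\<dots> = \<tau> * S + (\<Sum>p\<in>?Q. ?Z p (fst y) * ?Z p (snd y))"
        using sum_X[of h] h by (simp add: sum.distrib sum_distrib_left[symmetric] sum.inter_filter[symmetric])
      finally show ?thesis by (simp add: \<tau>_def power2_eq_square)
    qed
    then have "pexp (pair_pmf H H) (\<lambda>y. \<Sum>p\<in>blocks h. (resid (f(h := y)) h p)\<^sup>2) \<le>
        pexp (pair_pmf H H) (\<lambda>y. 8 * S\<^sup>2 / w + (\<Sum>p\<in>?Q. ?Z p (fst y) * ?Z p (snd y)))"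
      by (intro pexp_mono[OF finHH])
    also have "\<dots> = 8 * S\<^sup>2 / w + (\<Sum>p\<in>?Q. pexp H (?Z p) * pexp H (?Z p))"
      by (subst pexp_add[OF finHH], subst pexp_sum[OF finHH], subst pexp_pair[OF finH finH]) simp
    also have "\<dots> \<le> 8 * S\<^sup>2 / w + (\<Sum>p\<in>?Q. S / w * (S / w))"
    proof -
      have "pexp H (?Z p) \<ge> 0" for p by (intro integral_nonneg_AE) (simp add: colliding_X_nonneg)
      then show ?thesis using expected_colliding_X[of h] h S_nonneg by (intro add_left_mono sum_mono mult_mono) auto
    qed
    also have "\<dots> = 8 * S\<^sup>2 / w + real (card ?Q) * (S / w)\<^sup>2" by (simp add: power2_eq_square)
    also have "\<dots> \<le> 8 * S\<^sup>2 / w + real (2 * card {p\<in>blocks (Suc h). heavy_at f (Suc h) p}) * (S / w)\<^sup>2"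
      using card_heavy_parent[OF h, of f] by (intro add_left_mono mult_right_mono) (auto simp del: of_nat_mult)
    finally show ?thesis by (simp add: mult_ac)
  qed
  have "pexp F1 (\<lambda>f. \<Sum>p\<in>blocks h. (resid f h p)\<^sup>2) \<le>
     pexp F1 (\<lambda>f. 8 * S\<^sup>2 / w + real (card {p\<in>blocks (Suc h). heavy_at f (Suc h) p}) * (2 * (S / w)\<^sup>2))"
    by (subst pexp_F1_resample[OF h]) (intro pexp_mono[OF finF1] inner)
  also have "\<dots> = 8 * S\<^sup>2 / w + pexp F1 (\<lambda>f. real (card {p\<in>blocks (Suc h). heavy_at f (Suc h) p})) * (2 * (S / w)\<^sup>2)"
    by (subst pexp_add[OF finF1]) simp
  also have "\<dots> \<le> 8 * S\<^sup>2 / w + w / 2 * (2 * (S / w)\<^sup>2)"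
    using expected_heavy[OF S, of "Suc h"] h by (intro add_left_mono mult_right_mono) auto
  also have "\<dots> = 9 * S\<^sup>2 / w" by (simp add: field_simps power2_eq_square)
  finally show ?thesis .
qed

end

section \<open>Search paths in the dyadic tree\<close>


text \<open>\<open>N h p\<close> stands for the weight of block \<open>p\<close> at level \<open>h\<close>, i.e. of the items \<open>v\<close> with
  \<open>v div 2 ^ h = p\<close>. The left end at level \<open>h\<close> is the weight of all items left of the level \<open>h\<close> block of
  \<open>u\<close>: a left sibling counts whenever the path goes right. The mid point at level \<open>h\<close> lies between the two
  children of the level \<open>h + 1\<close> block of \<open>u\<close>, so it is the quantity that a search at this block compares
  with the query.\<close>

definition left_end :: "nat \<Rightarrow> (nat \<Rightarrow> nat \<Rightarrow> real) \<Rightarrow> nat \<Rightarrow> nat \<Rightarrow> real" where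
  "left_end L N u h = (\<Sum>i\<in>{h..<L}. if bit u i then N i (2 * (u div 2 ^ Suc i)) else 0)"

definition mid_point :: "nat \<Rightarrow> (nat \<Rightarrow> nat \<Rightarrow> real) \<Rightarrow> nat \<Rightarrow> nat \<Rightarrow> real" where
  "mid_point L N u h = left_end L N u (Suc h) + N h (2 * (u div 2 ^ Suc h))"

definition accepts :: "nat \<Rightarrow> (nat \<Rightarrow> nat \<Rightarrow> real) \<Rightarrow> real \<Rightarrow> real \<Rightarrow> nat \<Rightarrow> bool" where
  "accepts L N q a u \<longleftrightarrow> (\<forall>h<L. (bit u h \<longrightarrow> mid_point L N u h \<le> q + a) \<and>
                                (\<not> bit u h \<longrightarrow> mid_point L N u h \<ge> q - a))"

lemma left_end_Suc: "h < L \<Longrightarrow> left_end L N u h = (if bit u h then mid_point L N u h else left_end L N u (Suc h))"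
  by (simp add: left_end_def mid_point_def sum.atLeast_Suc_lessThan)

lemma path_node_less:
  assumes "u < 2 ^ L" "h < L"
  shows "2 * (u div 2 ^ Suc h) < (2::nat) ^ (L - h)"
proof -
  have "(2::nat) ^ L = 2 ^ (L - Suc h) * 2 ^ Suc h" using assms(2) by (subst power_add[symmetric]) simp
  with assms(1) have "u div 2 ^ Suc h < 2 ^ (L - Suc h)" by (intro less_mult_imp_div_less) simp
  moreover have "L - h = Suc (L - Suc h)" using assms(2) by simp
  ultimately show ?thesis by simp
qed

lemma left_end_cong:
  assumes "u < 2 ^ L" "\<And>h p. h < L \<Longrightarrow> p < 2 ^ (L - h) \<Longrightarrow> N h p = N' h p"
  shows "left_end L N u h = left_end L N' u h"
  unfolding left_end_def using assms path_node_less[OF assms(1)] by (intro sum.cong) auto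

lemma mid_point_cong:
  assumes "u < 2 ^ L" "h < L" "\<And>h p. h < L \<Longrightarrow> p < 2 ^ (L - h) \<Longrightarrow> N h p = N' h p"
  shows "mid_point L N u h = mid_point L N' u h"
  unfolding mid_point_def using left_end_cong[OF assms(1,3)] assms path_node_less[OF assms(1)] by simp

text \<open>The mid point involves only the common ancestors and the left child at level
  \<open>h\<close>. Two leaves that have not yet separated thus face the same comparison, which
  carries the accuracy of one path over to other leaves.\<close>

lemma mid_point_same_block:
  assumes "u div 2 ^ Suc h = v div 2 ^ Suc h"
  shows "mid_point L N u h = mid_point L N v h"
proof -
  have div: "u div 2 ^ i = v div 2 ^ i" if "Suc h \<le> i" for i
  proof -
    have "u div 2 ^ i = u div 2 ^ Suc h div 2 ^ (i - Suc h)" for u :: nat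
      using that by (simp add: div_mult2_eq[symmetric] power_add[symmetric] del: power_Suc)
    then show ?thesis using assms by metis
  qed
  have "left_end L N u (Suc h) = left_end L N v (Suc h)"
    unfolding left_end_def using div by (intro sum.cong) (auto simp: bit_iff_odd simp del: power_Suc)
  with assms show ?thesis by (simp add: mid_point_def)
qed

text \<open>At the highest differing bit the two paths part, the larger leaf going right. Halving
  both numbers leads to this bit: it is bit 0 once the halves agree.\<close>

lemma top_differing_bit:
  assumes "u < (v::nat)"
  shows "\<exists>h. bit v h \<and> \<not> bit u h \<and> u div 2 ^ Suc h = v div 2 ^ Suc h"
  using assms
proof (induction v arbitrary: u rule: less_induct)
  case (less v)
  show ?case
  proof (cases "u div 2 = v div 2")
    case True
    with less.prems have "even u" "odd v" by presburger+
    with True show ?thesis by (intro exI[of _ 0]) (simp add: bit_0)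
  next
    case False
    with less.prems have "u div 2 < v div 2" by presburger
    with less.IH[of "v div 2" "u div 2"] less.prems obtain h where
      "bit (v div 2) h" "\<not> bit (u div 2) h" "u div 2 div 2 ^ Suc h = v div 2 div 2 ^ Suc h" by auto
    then have "bit v (Suc h)" "\<not> bit u (Suc h)" "u div 2 ^ Suc (Suc h) = v div 2 ^ Suc (Suc h)"
      by (simp_all only: bit_Suc power_Suc[of 2 "Suc h"] div_mult2_eq not_False_eq_True)
    then show ?thesis by blast
  qed
qed

lemma nat_div_eq_iff:
  assumes "(0::nat) < n"
  shows "v div n = p \<longleftrightarrow> n * p \<le> v \<and> v < n * p + n"
proof -
  have "v div n = p \<longleftrightarrow> p \<le> v div n \<and> v div n < Suc p" by auto
  then show ?thesis
    using assms by (simp only: less_eq_div_iff_mult_less_eq div_less_iff_less_mult mult.commute[of n] mult_Suc add.commute)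
qed

lemma bit_imp_le: "bit (u::nat) h \<Longrightarrow> 2 ^ h \<le> u"
  by (metis bit_iff_odd div_less even_zero not_le_imp_less)

section \<open>Reading block estimates off the counters\<close>

type_synonym row_seed = "(nat \<Rightarrow> (nat \<Rightarrow> nat) \<times> (nat \<Rightarrow> nat)) \<times> (nat \<Rightarrow> (nat \<Rightarrow> nat) \<times> (nat \<Rightarrow> bool))"

text \<open>Tables 0 and 1 are the Count-Min tables of a level, table 2 is the Count-Sketch table.\<close>

definition row_coef :: "row_seed \<Rightarrow> nat \<Rightarrow> nat \<times> nat \<times> nat \<Rightarrow> int" where
  "row_coef s v = (\<lambda>(h, t, b). let p = v div 2 ^ h in
     if t = 0 then of_bool (fst (fst s h) p = b)
     else if t = 1 then of_bool (snd (fst s h) p = b)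
     else if fst (snd s h) p = b then (if snd (snd s h) p then 1 else - 1) else 0)"

definition read_count_min :: "(nat \<times> nat \<times> nat \<Rightarrow> real) \<Rightarrow> (nat \<Rightarrow> (nat \<Rightarrow> nat) \<times> (nat \<Rightarrow> nat)) \<Rightarrow> nat \<Rightarrow> nat \<Rightarrow> real" where
  "read_count_min c f h p = min (c (h, 0, fst (f h) p)) (c (h, 1, snd (f h) p))"

text \<open>The sketch is linear, so the Count-Sketch table of the residual is obtained at query
  time by subtracting the table of the guesses from the stored one.\<close>

definition node_estimate :: "nat \<Rightarrow> real \<Rightarrow> (nat \<times> nat \<times> nat \<Rightarrow> real) \<Rightarrow> row_seed \<Rightarrow> nat \<Rightarrow> nat \<Rightarrow> real" where
  "node_estimate L \<tau> c s h p = (let y = guess L \<tau> (read_count_min c (fst s)) h; (g, \<sigma>) = snd s h in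
     y p + sg (\<sigma> p) * (c (h, 2, g p) - (\<Sum>r<2 ^ (L - h). of_bool (g r = g p) * sg (\<sigma> r) * y r)))"

section \<open>Exact comparisons along a path and their tolerance to errors\<close>

context dyadic
begin

definition prefix_sum :: "nat \<Rightarrow> real" where "prefix_sum m = (\<Sum>v<m. x v)"

lemma prefix_sum_mono: "m \<le> m' \<Longrightarrow> prefix_sum m \<le> prefix_sum m'"
  unfolding prefix_sum_def by (intro sum_mono2) (auto simp: x_nonneg)

lemma X_eq_prefix_sum:
  assumes "h \<le> L" "p < 2 ^ (L - h)"
  shows "prefix_sum (2 ^ h * p) + X h p = prefix_sum (2 ^ h * p + 2 ^ h)"
proof -
  have "2 ^ h * p + 2 ^ h = 2 ^ h * Suc p" by simp
  also have "\<dots> \<le> 2 ^ h * 2 ^ (L - h)" using assms(2) by (intro mult_le_mono) auto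
  also have "\<dots> = 2 ^ L" using assms(1) by (simp flip: power_add)
  finally have le: "2 ^ h * p + 2 ^ h \<le> 2 ^ L" .
  then have "{v. v < 2 ^ L \<and> v div 2 ^ h = p} = {2 ^ h * p..<2 ^ h * p + 2 ^ h}"
    by (auto simp: nat_div_eq_iff)
  moreover have "sum x {0..<2 ^ h * p} + sum x {2 ^ h * p..<2 ^ h * p + 2 ^ h} = sum x {0..<2 ^ h * p + 2 ^ h}"
    by (intro sum.atLeastLessThan_concat) simp_all
  ultimately show ?thesis unfolding mass_def prefix_sum_def lessThan_atLeast0 by simp
qed

text \<open>With exact weights the sums telescope: the left end is the weight left of the block's
  boundary, the mid point the weight left of the boundary between the children. The induction
  descends from the root, which starts at 0.\<close>

lemma left_end_X:
  assumes "u < 2 ^ L" "h \<le> L"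
  shows "left_end L X u h = prefix_sum (2 ^ h * (u div 2 ^ h))"
    and "h < L \<Longrightarrow> mid_point L X u h = prefix_sum (2 ^ Suc h * (u div 2 ^ Suc h) + 2 ^ h)"
proof -
  have *: "left_end L X u h = prefix_sum (2 ^ h * (u div 2 ^ h)) \<and>
    (h < L \<longrightarrow> mid_point L X u h = prefix_sum (2 ^ Suc h * (u div 2 ^ Suc h) + 2 ^ h))"
    using assms(2)
  proof (induction h rule: inc_induct)
    case base
    show ?case using assms(1) by (simp add: left_end_def prefix_sum_def)
  next
    case (step h)
    have mid: "mid_point L X u h = prefix_sum (2 ^ Suc h * (u div 2 ^ Suc h) + 2 ^ h)"
      using step X_eq_prefix_sum[of h "2 * (u div 2 ^ Suc h)"] path_node_less[OF assms(1) step(2)]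
      by (simp add: mid_point_def mult_ac)
    have "u div 2 ^ h = 2 * (u div 2 ^ Suc h) + of_bool (bit u h)"
    proof -
      have "u div 2 ^ Suc h = u div 2 ^ h div 2" by (simp add: div_mult2_eq[symmetric] mult.commute)
      then show ?thesis using mult_div_mod_eq[of 2 "u div 2 ^ h"] by (simp add: bit_iff_odd mod_2_eq_odd)
    qed
    then have "2 ^ h * (u div 2 ^ h) = 2 ^ Suc h * (u div 2 ^ Suc h) + (if bit u h then 2 ^ h else 0)"
      by (auto simp: algebra_simps)
    then show ?case using step mid by (simp add: left_end_Suc)
  qed
  then show "left_end L X u h = prefix_sum (2 ^ h * (u div 2 ^ h))"
    and "h < L \<Longrightarrow> mid_point L X u h = prefix_sum (2 ^ Suc h * (u div 2 ^ Suc h) + 2 ^ h)" by blast+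
qed

text \<open>After a right turn the mid point is the left boundary of a block containing
  \<open>u\<close>.\<close>

lemma mid_point_X_le:
  assumes "u < 2 ^ L" "h < L" "bit u h"
  shows "mid_point L X u h \<le> prefix_sum u"
proof -
  have "left_end L X u h = mid_point L X u h" using assms by (simp add: left_end_Suc)
  moreover have "2 ^ h * (u div 2 ^ h) \<le> u" by simp
  ultimately show ?thesis
    using left_end_X(1)[OF assms(1), of h] assms(2) prefix_sum_mono[of "2 ^ h * (u div 2 ^ h)" u] by simp
qed

text \<open>After a left turn \<open>u\<close> lies in the left child, which ends at the mid
  point.\<close>

lemma mid_point_X_ge:
  assumes "u < 2 ^ L" "h < L" "\<not> bit u h"
  shows "mid_point L X u h \<ge> prefix_sum (Suc u)"
proof -
  have "u div 2 ^ Suc h = u div 2 ^ h div 2" by (simp add: div_mult2_eq[symmetric] mult.commute)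
  then have "u div 2 ^ h = 2 * (u div 2 ^ Suc h)"
    using assms(3) mult_div_mod_eq[of 2 "u div 2 ^ h"] by (simp add: bit_iff_odd)
  then have "u = 2 ^ Suc h * (u div 2 ^ Suc h) + u mod 2 ^ h"
    using mult_div_mod_eq[of "2 ^ h" u] by simp
  moreover have "u mod 2 ^ h < 2 ^ h" by simp
  ultimately have "Suc u \<le> 2 ^ Suc h * (u div 2 ^ Suc h) + 2 ^ h" by linarith
  then show ?thesis using left_end_X(2)[OF assms(1), of h] assms(2) prefix_sum_mono by simp
qed

text \<open>Mid points rather than left ends, because a search also compares where its path goes
  left and the left child does not enter the left end.\<close>

definition good_path :: "(nat \<Rightarrow> nat \<Rightarrow> real) \<Rightarrow> real \<Rightarrow> nat \<Rightarrow> bool" where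
  "good_path N a u \<longleftrightarrow> (\<forall>h<L. \<bar>mid_point L N u h - mid_point L X u h\<bar> \<le> a)"

text \<open>A left end is the mid point of the last right turn, or 0 if there was none, so its error
  is never larger than that of a single mid point.\<close>

lemma good_path_left_end:
  assumes "good_path N a u" "u < 2 ^ L" "a \<ge> 0"
  shows "\<bar>left_end L N u 0 - prefix_sum u\<bar> \<le> a"
proof -
  have "\<bar>left_end L N u h - left_end L X u h\<bar> \<le> a" if "h \<le> L" for h
    using that
  proof (induction h rule: inc_induct)
    case base
    then show ?case using assms by (simp add: left_end_def)
  next
    case (step h)
    then show ?case using assms(1) by (simp add: left_end_Suc good_path_def)
  qed
  from this[of 0] left_end_X(1)[OF assms(2), of 0] show ?thesis by simp
qed

lemma good_path_accepts:
  assumes "good_path N a u" "u < 2 ^ L" "prefix_sum u \<le> q" "q \<le> prefix_sum (Suc u)"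
  shows "accepts L N q a u"
  unfolding accepts_def
proof (intro allI impI conjI)
  fix h assume h: "h < L"
  have d: "\<bar>mid_point L N u h - mid_point L X u h\<bar> \<le> a" using assms(1) h by (simp add: good_path_def)
  show "mid_point L N u h \<le> q + a" if "bit u h"
    using mid_point_X_le[OF assms(2) h that] assms(3) d by linarith
  show "mid_point L N u h \<ge> q - a" if "\<not> bit u h"
    using mid_point_X_ge[OF assms(2) h that] assms(4) d by linarith
qed

text \<open>Where the paths part, \<open>v\<close> goes right, so the exact mid point is at most
  \<open>prefix_sum v\<close> and its estimate is below \<open>q - a\<close>. Leaf \<open>u\<close>
  goes left at the same comparison and would need at least \<open>q - a\<close>. Only the path to
  \<open>v\<close> has to be accurate.\<close>

lemma good_path_rejects_below:
  assumes "good_path N a v" "v < 2 ^ L" "prefix_sum v < q - 2 * a" "u < v"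
  shows "\<not> accepts L N q a u"
proof
  assume acc: "accepts L N q a u"
  obtain h where h: "bit v h" "\<not> bit u h" "u div 2 ^ Suc h = v div 2 ^ Suc h"
    using top_differing_bit[OF assms(4)] by blast
  have "(2::nat) ^ h < 2 ^ L" using bit_imp_le[OF h(1)] assms(2) by linarith
  then have hL: "h < L" by simp
  have "mid_point L X v h \<le> prefix_sum v" using mid_point_X_le[OF assms(2) hL h(1)] .
  moreover have "\<bar>mid_point L N v h - mid_point L X v h\<bar> \<le> a" using assms(1) hL by (simp add: good_path_def)
  moreover have "mid_point L N u h \<ge> q - a" using acc hL h(2) by (simp add: accepts_def)
  ultimately show False using assms(3) mid_point_same_block[OF h(3), of L N] by linarith
qed

text \<open>The mirror image: \<open>v\<close> goes left where \<open>u\<close> goes right, and the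
  estimate exceeds \<open>q + a\<close>.\<close>

lemma good_path_rejects_above:
  assumes "good_path N a v" "prefix_sum (Suc v) > q + 2 * a" "v < u" "u < 2 ^ L"
  shows "\<not> accepts L N q a u"
proof
  assume acc: "accepts L N q a u"
  obtain h where h: "bit u h" "\<not> bit v h" "v div 2 ^ Suc h = u div 2 ^ Suc h"
    using top_differing_bit[OF assms(3)] by blast
  have "(2::nat) ^ h < 2 ^ L" using bit_imp_le[OF h(1)] assms(4) by linarith
  then have hL: "h < L" by simp
  have "mid_point L X v h \<ge> prefix_sum (Suc v)" using mid_point_X_ge[OF _ hL h(2)] assms(3,4) by simp
  moreover have "\<bar>mid_point L N v h - mid_point L X v h\<bar> \<le> a" using assms(1) hL by (simp add: good_path_def)
  moreover have "mid_point L N u h \<le> q + a" using acc hL h(1) by (simp add: accepts_def)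
  ultimately show False using assms(2) mid_point_same_block[OF h(3), of L N] by linarith
qed

end

section \<open>Random errors along a fixed path\<close>

context dyadic_sketch
begin

definition noisy :: "row_seed \<Rightarrow> nat \<Rightarrow> nat \<Rightarrow> real" where
  "noisy s h p = X h p + sketch_error (blocks h) (resid (fst s) h) p (snd s h)"

text \<open>With the Count-Min seeds fixed, the error of a mid point is a partial sum of independent
  centred errors over the right turns above, plus the error of one left child. The partial sums are
  controlled by the maximal inequality and the last terms by a union bound, both at
  \<open>a / 2\<close>. The union bound costs no more, since it too sums the variances; together
  they give the factor 8.\<close>

lemma prob_bad_path_cond:
  assumes u: "u < 2 ^ L" and a: "a > 0"
  shows "measure_pmf.prob F2 {f2. \<not> good_path (noisy (f1, f2)) a u}
           \<le> 8 * (\<Sum>h<L. \<Sum>p\<in>blocks h. (resid f1 h p)\<^sup>2) / (w * a\<^sup>2)"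
proof -
  let ?n = "\<lambda>h. 2 * (u div 2 ^ Suc h)"
  define e where "e h z = sketch_error (blocks h) (resid f1 h) (?n h) z" for h z
  \<comment> \<open>A left turn adds nothing to the left end, so its error is replaced by 0.\<close>
  define e' where "e' h z = (if bit u h then e h z else 0)" for h z
  define V where "V h = (\<Sum>p\<in>blocks h. (resid f1 h p)\<^sup>2) / w" for h
  have mean: "pexp (pair_pmf H B) (e h) = 0" and var: "pexp (pair_pmf H B) (\<lambda>z. (e h z)\<^sup>2) \<le> V h" if "h < L" for h
    unfolding e_def V_def using sketch_error[OF H B blocks_subset, of "?n h" h "resid f1 h"] path_node_less[OF u that] by auto
  have V0: "V h \<ge> 0" for h unfolding V_def by (intro divide_nonneg_nonneg sum_nonneg) auto
  define A where "A = {f. \<exists>h\<le>L. \<bar>0 + (\<Sum>i\<in>{h..<L}. e' i (f i))\<bar> > a / 2}"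
  define A' where "A' h = {f. \<bar>e h (f h)\<bar> \<ge> a / 2}" for h
  have sub: "{f2. \<not> good_path (noisy (f1, f2)) a u} \<subseteq> A \<union> (\<Union>h<L. A' h)"
  proof
    fix f2 assume "f2 \<in> {f2. \<not> good_path (noisy (f1, f2)) a u}"
    then obtain h where h: "h < L" "\<bar>mid_point L (noisy (f1, f2)) u h - mid_point L X u h\<bar> > a"
      by (auto simp: good_path_def not_le)
    have "left_end L (noisy (f1, f2)) u (Suc h) - left_end L X u (Suc h) = (\<Sum>i\<in>{Suc h..<L}. e' i (f2 i))"
      unfolding left_end_def sum_subtractf[symmetric]
      by (intro sum.cong) (auto simp: noisy_def e_def e'_def)
    then have "mid_point L (noisy (f1, f2)) u h - mid_point L X u h = (\<Sum>i\<in>{Suc h..<L}. e' i (f2 i)) + e h (f2 h)"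
      by (simp add: mid_point_def noisy_def e_def)
    with h(2) have "\<bar>\<Sum>i\<in>{Suc h..<L}. e' i (f2 i)\<bar> > a / 2 \<or> \<bar>e h (f2 h)\<bar> \<ge> a / 2" by linarith
    then show "f2 \<in> A \<union> (\<Union>h<L. A' h)" using h(1) unfolding A_def A'_def by (auto intro!: exI[of _ "Suc h"])
  qed
  have "measure_pmf.prob F2 A \<le> (0\<^sup>2 + (\<Sum>h<L. V h)) / (a / 2)\<^sup>2"
    unfolding A_def row_seeds2_def
  proof (rule kolmogorov_maximal)
    fix h assume h: "h < L"
    show "pexp (pair_pmf H B) (e' h) = 0" using mean[OF h] by (cases "bit u h") (simp_all add: e'_def[abs_def])
    show "pexp (pair_pmf H B) (\<lambda>z. (e' h z)\<^sup>2) \<le> V h" using var[OF h] V0[of h] by (cases "bit u h") (simp_all add: e'_def[abs_def])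
  qed (use a finHB in auto)
  moreover have "measure_pmf.prob F2 (A' h) \<le> V h / (a / 2)\<^sup>2" if h: "h < L" for h
  proof -
    have "measure_pmf.prob F2 (A' h) \<le> pexp F2 (\<lambda>f. (e h (f h))\<^sup>2) / (a / 2)\<^sup>2"
    proof (rule markov_pmf[OF finF2])
      fix f assume "f \<in> A' h"
      then have "\<bar>a / 2\<bar> \<le> \<bar>e h (f h)\<bar>" using a by (simp add: A'_def)
      then show "(a / 2)\<^sup>2 \<le> (e h (f h))\<^sup>2" by (simp only: abs_le_square_iff)
    qed (use a in auto)
    also have "pexp F2 (\<lambda>f. (e h (f h))\<^sup>2) = pexp (pair_pmf H B) (\<lambda>z. (e h z)\<^sup>2)"
      unfolding row_seeds2_def using h finHB by (subst pexp_Pi_component) auto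
    also have "\<dots> / (a / 2)\<^sup>2 \<le> V h / (a / 2)\<^sup>2" by (intro divide_right_mono var[OF h]) auto
    finally show ?thesis .
  qed
  then have "(\<Sum>h<L. measure_pmf.prob F2 (A' h)) \<le> (\<Sum>h<L. V h / (a / 2)\<^sup>2)" by (intro sum_mono) auto
  moreover have "measure_pmf.prob F2 {f2. \<not> good_path (noisy (f1, f2)) a u} \<le>
      measure_pmf.prob F2 A + (\<Sum>h<L. measure_pmf.prob F2 (A' h))"
  proof -
    have "measure_pmf.prob F2 {f2. \<not> good_path (noisy (f1, f2)) a u} \<le> measure_pmf.prob F2 (A \<union> (\<Union>h<L. A' h))"
      by (intro measure_pmf.finite_measure_mono sub) simp
    also have "\<dots> \<le> measure_pmf.prob F2 A + measure_pmf.prob F2 (\<Union>h<L. A' h)"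
      by (intro measure_Un_le) auto
    also have "measure_pmf.prob F2 (\<Union>h<L. A' h) \<le> (\<Sum>h<L. measure_pmf.prob F2 (A' h))"
      by (intro measure_pmf.finite_measure_subadditive_finite) auto
    finally show ?thesis by simp
  qed
  ultimately have "measure_pmf.prob F2 {f2. \<not> good_path (noisy (f1, f2)) a u} \<le>
      2 * ((\<Sum>h<L. V h) / (a / 2)\<^sup>2)"
    by (simp add: sum_divide_distrib)
  also have "\<dots> = 8 * (\<Sum>h<L. \<Sum>p\<in>blocks h. (resid f1 h p)\<^sup>2) / (w * a\<^sup>2)"
    using a by (simp add: V_def sum_divide_distrib[symmetric] field_simps power2_eq_square)
  finally show ?thesis .
qed

text \<open>Averages over the Count-Min seeds, of which the Count-Sketch seeds are independent; 72
  is 8 times the 9 of \<open>expected_resid\<close>.\<close>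

lemma prob_bad_path:
  assumes "u < 2 ^ L" "a > 0" "S > 0"
  shows "measure_pmf.prob (pair_pmf F1 F2) {s. \<not> good_path (noisy s) a u} \<le> 72 * real L * S\<^sup>2 / (w\<^sup>2 * a\<^sup>2)"
proof -
  have "measure_pmf.prob (pair_pmf F1 F2) {s. \<not> good_path (noisy s) a u} =
      pexp F1 (\<lambda>f1. measure_pmf.prob F2 {f2. \<not> good_path (noisy (f1, f2)) a u})"
    using prob_pair[OF finF1 finF2, of "\<lambda>f1 f2. \<not> good_path (noisy (f1, f2)) a u"] by simp
  also have "\<dots> \<le> pexp F1 (\<lambda>f1. 8 * (\<Sum>h<L. \<Sum>p\<in>blocks h. (resid f1 h p)\<^sup>2) / (w * a\<^sup>2))"
    by (intro pexp_mono[OF finF1] prob_bad_path_cond assms)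
  also have "\<dots> = 8 * (\<Sum>h<L. pexp F1 (\<lambda>f1. \<Sum>p\<in>blocks h. (resid f1 h p)\<^sup>2)) / (w * a\<^sup>2)"
    by (simp add: pexp_sum[OF finF1])
  also have "\<dots> \<le> 8 * (\<Sum>h<L. 9 * S\<^sup>2 / w) / (w * a\<^sup>2)"
    using expected_resid[OF assms(3)] by (intro divide_right_mono mult_left_mono sum_mono) auto
  also have "\<dots> = 72 * real L * S\<^sup>2 / (w\<^sup>2 * a\<^sup>2)" by (simp add: power2_eq_square)
  finally show ?thesis .
qed

lemma sum_blocks_split:
  assumes "h \<le> L" "p \<in> blocks h"
  shows "(\<Sum>v<2 ^ L. of_bool (g (v div 2 ^ h) = g p) * c (v div 2 ^ h) * x v) =
         c p * X h p + (\<Sum>r\<in>blocks h - {p}. of_bool (g r = g p) * c r * X h r)"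
  using sum_mass[OF assms(1), of "\<lambda>r. of_bool (g r = g p) * c r" x] assms(2)
  by (simp add: sum.remove[of "blocks h" p])

text \<open>In the residual bucket the term of \<open>p\<close> meets its own sign twice and
  restores exactly what the guess of \<open>p\<close> missed. Only the colliding blocks remain as
  error.\<close>

lemma node_estimate_noisy:
  assumes c: "\<And>h t b. h < L \<Longrightarrow> t < 3 \<Longrightarrow> b < 2 ^ k \<Longrightarrow> c (h, t, b) = (\<Sum>v<2 ^ L. of_int (row_coef s v (h, t, b)) * x v)"
    and s: "s \<in> set_pmf (pair_pmf F1 F2)" and h: "h < L" and p: "p \<in> blocks h"
  shows "node_estimate L \<tau> c s h p = noisy s h p"
proof -
  obtain f1 f2 where sf: "s = (f1, f2)" by fastforce
  have f1: "f1 h \<in> set_pmf (pair_pmf H H)" and f2: "f2 h \<in> set_pmf (pair_pmf H B)" if "h < L" for h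
    using s that unfolding sf row_seeds1_def row_seeds2_def by (auto simp: set_Pi_pmf PiE_dflt_def)
  have bound: "fst (f1 h) r < 2 ^ k" "snd (f1 h) r < 2 ^ k" "fst (f2 h) r < 2 ^ k" if "h < L" for h r
    using f1[OF that] f2[OF that] H by (auto simp: universal_hash_def mem_Times_iff)
  have cm: "read_count_min c f1 h p = count_min L x f1 h p" if h: "h < L" and p: "p \<in> blocks h" for h p
    using sum_blocks_split[of h p "fst (f1 h)" "\<lambda>_. 1"] sum_blocks_split[of h p "snd (f1 h)" "\<lambda>_. 1"] h p
    by (simp add: read_count_min_def count_min_def c bound row_coef_def sf colliding_def)
  have gs: "guess L \<tau> (read_count_min c f1) h r = X h r - resid f1 h r" if r: "r \<in> blocks h" for r
  proof -
    have "r div 2 ^ (i - h) < 2 ^ (L - i)" if "h \<le> i" "i < L" for i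
      using r that by (intro less_mult_imp_div_less) (simp flip: power_add)
    then have "heavy L \<tau> (read_count_min c f1) h r = heavy L \<tau> (count_min L x f1) h r"
      by (intro heavy_cong cm) auto
    then show ?thesis using cm[OF h r] by (simp add: resid_def guess_def)
  qed
  obtain g \<sigma> where f2h: "f2 h = (g, \<sigma>)" by fastforce
  have "c (h, 2, g p) = (\<Sum>v<2 ^ L. of_bool (g (v div 2 ^ h) = g p) * sg (\<sigma> (v div 2 ^ h)) * x v)"
    using bound(3)[OF h, of p] h by (auto simp: c row_coef_def sf f2h sg_def Let_def intro!: sum.cong)
  also have "\<dots> = sg (\<sigma> p) * X h p + (\<Sum>r\<in>blocks h - {p}. of_bool (g r = g p) * sg (\<sigma> r) * X h r)"
    using h p by (subst sum_blocks_split) auto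
  finally have c2: "c (h, 2, g p) = \<dots>" .
  have "(\<Sum>r\<in>blocks h. of_bool (g r = g p) * sg (\<sigma> r) * guess L \<tau> (read_count_min c f1) h r) =
      (\<Sum>r\<in>blocks h. of_bool (g r = g p) * sg (\<sigma> r) * (X h r - resid f1 h r))"
    by (intro sum.cong refl) (simp add: gs)
  also have "\<dots> = sg (\<sigma> p) * (X h p - resid f1 h p) +
      (\<Sum>r\<in>blocks h - {p}. of_bool (g r = g p) * sg (\<sigma> r) * (X h r - resid f1 h r))"
    using p by (subst sum.remove[of "blocks h" p]) auto
  finally have "c (h, 2, g p) - (\<Sum>r\<in>blocks h. of_bool (g r = g p) * sg (\<sigma> r) * guess L \<tau> (read_count_min c f1) h r) =
      sg (\<sigma> p) * resid f1 h p + (\<Sum>r\<in>blocks h - {p}. of_bool (g r = g p) * sg (\<sigma> r) * resid f1 h r)"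
    unfolding c2 by (simp add: algebra_simps sum_subtractf)
  then have "node_estimate L \<tau> c s h p = X h p - resid f1 h p + sg (\<sigma> p) *
      (sg (\<sigma> p) * resid f1 h p + (\<Sum>r\<in>blocks h - {p}. of_bool (g r = g p) * sg (\<sigma> r) * resid f1 h r))"
    using gs[OF p] by (simp add: node_estimate_def sf f2h Let_def)
  also have "\<dots> = X h p + (\<Sum>r\<in>blocks h - {p}. sg (\<sigma> p) * (of_bool (g r = g p) * sg (\<sigma> r) * resid f1 h r))"
    by (simp add: distrib_left sum_distrib_left)
  also have "\<dots> = noisy s h p"
    by (simp add: noisy_def sketch_error_def sf f2h mult_ac)
  finally show ?thesis .
qed

end

section \<open>Independent repetitions\<close>


definition row_seeds :: "nat \<Rightarrow> (nat \<Rightarrow> nat) pmf \<Rightarrow> (nat \<Rightarrow> bool) pmf \<Rightarrow> row_seed pmf" where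
  "row_seeds L H B = pair_pmf (row_seeds1 L H) (row_seeds2 L H B)"

text \<open>Each level draws three hash functions and one sign function, hence
  \<open>3 * k + 1\<close> factors of \<open>N\<close>. For \<open>N = 2 ^ L\<close> one factor is
  what a single word stores.\<close>

lemma card_row_seeds:
  assumes H: "universal_hash N k H" and B: "pairwise_bits N B"
  shows "finite (set_pmf (row_seeds L H B))" "card (set_pmf (row_seeds L H B)) \<le> N ^ ((3 * k + 1) * L)"
proof -
  have fin: "finite (set_pmf H)" "finite (set_pmf B)" and card: "card (set_pmf H) \<le> N ^ k" "card (set_pmf B) \<le> N"
    using H B by (simp_all add: universal_hash_def pairwise_bits_def)
  show "finite (set_pmf (row_seeds L H B))"
    using fin by (simp add: row_seeds_def row_seeds1_def row_seeds2_def finite_set_Pi_pmf)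
  have "card (set_pmf (row_seeds1 L H)) \<le> (N ^ k * N ^ k) ^ card {..<L}"
    unfolding row_seeds1_def using fin card by (intro card_set_Pi_pmf_le) (auto simp: card_cartesian_product mult_mono)
  moreover have "card (set_pmf (row_seeds2 L H B)) \<le> (N ^ k * N) ^ card {..<L}"
    unfolding row_seeds2_def using fin card by (intro card_set_Pi_pmf_le) (auto simp: card_cartesian_product mult_mono)
  ultimately have "card (set_pmf (row_seeds L H B)) \<le> (N ^ k * N ^ k) ^ L * (N ^ k * N) ^ L"
    unfolding row_seeds_def by (simp add: card_cartesian_product mult_mono)
  also have "\<dots> = N ^ ((3 * k + 1) * L)"
  proof -
    have "(k + k) * L + (k + 1) * L = (3 * k + 1) * L" by (simp add: algebra_simps)
    then show ?thesis by (simp only: power_add[symmetric] power_mult[symmetric] power_Suc2[symmetric] Suc_eq_plus1)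
  qed
  finally show "card (set_pmf (row_seeds L H B)) \<le> N ^ ((3 * k + 1) * L)" .
qed

text \<open>The zero extension makes the weights nonnegative everywhere and gives leaf 0, which is
  not an index of the universe, no weight.\<close>

definition items :: "nat \<Rightarrow> stream \<Rightarrow> nat \<Rightarrow> real" where
  "items U \<sigma> v = (if v \<in> {1..U} then stream_vec \<sigma> v else 0)"

lemma items_dyadic: "strict_turnstile U \<sigma> \<Longrightarrow> dyadic (items U \<sigma>)"
  by unfold_locales (simp add: items_def stream_vec_nonneg)

lemma sum_items:
  assumes "U < 2 ^ L"
  shows "(\<Sum>v<2 ^ L. c v * items U \<sigma> v) = (\<Sum>v\<in>{1..U}. c v * stream_vec \<sigma> v)"
proof -
  have "(\<Sum>v\<in>{1..U}. c v * stream_vec \<sigma> v) = (\<Sum>v\<in>{1..U}. c v * items U \<sigma> v)"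
    by (intro sum.cong) (auto simp: items_def)
  also have "\<dots> = (\<Sum>v<2 ^ L. c v * items U \<sigma> v)"
    using assms by (intro sum.mono_neutral_left) (auto simp: items_def)
  finally show ?thesis by simp
qed

lemma S_items: "U < 2 ^ L \<Longrightarrow> dyadic.S L (items U \<sigma>) = stream_rank \<sigma> U" if "strict_turnstile U \<sigma>"
  using sum_items[of U L "\<lambda>_. 1" \<sigma>] dyadic.S_def[OF items_dyadic[OF that], of L] by (simp add: stream_rank_def)

text \<open>The shift by one comes from the exclusive bound of \<open>prefix_sum\<close>.\<close>

lemma prefix_sum_items:
  assumes "strict_turnstile U \<sigma>" "u \<le> U"
  shows "dyadic.prefix_sum (items U \<sigma>) (Suc u) = stream_rank \<sigma> u"
proof -
  have "(\<Sum>v<Suc u. items U \<sigma> v) = (\<Sum>v\<in>{1..u}. items U \<sigma> v)"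
    by (intro sum.mono_neutral_right) (auto simp: items_def)
  also have "\<dots> = stream_rank \<sigma> u"
    unfolding stream_rank_def using assms(2) by (intro sum.cong) (auto simp: items_def)
  finally show ?thesis using dyadic.prefix_sum_def[OF items_dyadic[OF assms(1)]] by simp
qed

text \<open>A path is bad with probability at most \<open>1/48\<close>, so three paths stay within the failure
  probability \<open>1/16\<close> that the majority vote tolerates.\<close>

lemma amplified_sketch:
  fixes acc :: "'q \<Rightarrow> real \<Rightarrow> (nat \<Rightarrow> nat \<Rightarrow> real) \<Rightarrow> 'b \<Rightarrow> bool" and post :: "'q \<Rightarrow> real \<Rightarrow> 'b \<Rightarrow> 'a pmf"
  assumes U: "U < 2 ^ L" and W: "2 ^ L \<le> W" and \<epsilon>: "\<epsilon> > 0" and k: "k > 0" "128 * sqrt L / \<epsilon> \<le> 2 ^ k"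
  shows "\<exists>A. memory_size A = (3 * k + 1) * L * R + Suc (R * (L * (3 * 2 ^ k))) \<and> runs_in_memory W A \<and>
    (\<forall>\<sigma> q. strict_turnstile U \<sigma> \<longrightarrow>
      (\<exists>p. response A \<sigma> q = bind_pmf p (post q (stream_rank \<sigma> U)) \<and> finite (set_pmf p) \<and>
        (\<forall>a G Us. stream_rank \<sigma> U > 0 \<longrightarrow> finite Us \<longrightarrow> card Us \<le> 3 \<longrightarrow> Us \<subseteq> {..<2 ^ L} \<longrightarrow>
          (\<forall>N. (\<forall>u\<in>Us. dyadic.good_path L (items U \<sigma>) N (\<epsilon> * stream_rank \<sigma> U / 2) u) \<longrightarrow>
             acc q (stream_rank \<sigma> U) N a \<and> (\<forall>b. acc q (stream_rank \<sigma> U) N b \<longrightarrow> b \<in> G)) \<longrightarrow>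
          measure_pmf.prob p G \<ge> 1 - 1 / 2 ^ R)))"
proof -
  obtain B where B: "pairwise_bits (2 ^ L) B" using pairwise_bits_exist by blast
  obtain H where H: "universal_hash (2 ^ L) k H" using universal_hash_exist[OF B] by blast
  define d :: row_seed where "d = undefined"
  define D where "D = Pi_pmf {..<R} d (\<lambda>_. row_seeds L H B)"
  define I :: "(nat \<times> nat \<times> nat \<times> nat) set" where "I = {..<R} \<times> {..<L} \<times> {..<3} \<times> {..<2 ^ k}"
  \<comment> \<open>The extra counter \<open>None\<close> holds the norm, from which the threshold
    is computed at query time.\<close>
  define J where "J = insert None (Some ` I)"
  define coef :: "(nat \<Rightarrow> row_seed) \<Rightarrow> nat \<Rightarrow> (nat \<times> nat \<times> nat \<times> nat) option \<Rightarrow> int" where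
    "coef s v j = (case j of None \<Rightarrow> 1 | Some (r, i) \<Rightarrow> row_coef (s r) v i)" for s v j
  define est where "est c s r = node_estimate L (8 * c None / 2 ^ k) (\<lambda>i. c (Some (r, i))) (s r)"
    for c :: "(nat \<times> nat \<times> nat \<times> nat) option \<Rightarrow> real" and s :: "nat \<Rightarrow> row_seed" and r :: nat
  define choice where "choice q c s = (SOME b. R < 2 * card {r\<in>{..<R}. acc q (c None) (est c s r) b})"
    for q and c :: "(nat \<times> nat \<times> nat \<times> nat) option \<Rightarrow> real" and s :: "nat \<Rightarrow> row_seed"
  have finD: "finite (set_pmf D)" unfolding D_def using card_row_seeds(1)[OF H B] by (intro finite_set_Pi_pmf) auto
  have "card (set_pmf D) \<le> ((2 ^ L) ^ ((3 * k + 1) * L)) ^ card {..<R}"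
    unfolding D_def using card_row_seeds[OF H B] by (intro card_set_Pi_pmf_le) auto
  then have cardD: "card (set_pmf D) \<le> (2 ^ L) ^ ((3 * k + 1) * L * R)" by (simp add: power_mult)
  have J: "finite J" "card J = Suc (R * (L * (3 * 2 ^ k)))"
    unfolding J_def I_def by (auto simp: card_image card_cartesian_product)
  have coef: "coef s v j \<in> {-1, 0, 1}" for s v j
    by (auto simp: coef_def row_coef_def Let_def split: option.split)
  obtain A where A: "memory_size A = (3 * k + 1) * L * R + Suc (R * (L * (3 * 2 ^ k)))" "runs_in_memory W A"
    and resp: "\<And>\<sigma> V q. finite V \<Longrightarrow> fst ` set \<sigma> \<subseteq> V \<Longrightarrow>
       response A \<sigma> q = bind_pmf D (\<lambda>s. let c = (\<lambda>j. if j \<in> J then \<Sum>v\<in>V. of_int (coef s v j) * stream_vec \<sigma> v else 0)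
         in post q (c None) (choice q c s))"
    using linear_sketch[where dec = "\<lambda>q s c. post q (c None) (choice q c s)" and coef = coef, OF finD cardD _ J(1) coef, of W] W J(2)
    unfolding Let_def by auto
  show ?thesis
  proof (intro exI[of _ A] conjI allI impI A)
    fix \<sigma> q assume \<sigma>: "strict_turnstile U \<sigma>"
    define x where "x = items U \<sigma>"
    define T where "T = stream_rank \<sigma> U"
    interpret dyadic_sketch L x k H B
      unfolding x_def using items_dyadic[OF \<sigma>] k(1) H B by (simp add: dyadic_sketch_def dyadic_sketch_axioms_def)
    have SS: "dyadic.S L x = T" using S_items[OF \<sigma> U] by (simp add: x_def T_def)
    define c where "c s = (\<lambda>j. if j \<in> J then \<Sum>v\<in>{1..U}. of_int (coef s v j) * stream_vec \<sigma> v else 0)" for s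
    have cN: "c s None = T" for s by (simp add: c_def J_def coef_def T_def stream_rank_def)
    define p where "p = map_pmf (\<lambda>s. choice q (c s) s) D"
    have r: "response A \<sigma> q = bind_pmf p (post q T)"
      using resp[of "{1..U}" \<sigma> q] \<sigma> cN
      by (simp add: strict_turnstile_def p_def bind_map_pmf c_def[symmetric] Let_def)
    have "measure_pmf.prob p G \<ge> 1 - 1 / 2 ^ R"
      if T0: "T > 0" and Us: "finite Us" "card Us \<le> 3" "Us \<subseteq> {..<2 ^ L}"
        and ok: "\<And>N. (\<forall>u\<in>Us. dyadic.good_path L x N (\<epsilon> * T / 2) u) \<Longrightarrow>
             acc q T N a \<and> (\<forall>b. acc q T N b \<longrightarrow> b \<in> G)" for a G Us
    proof -
      let ?D = "row_seeds L H B"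
      define N where "N s = node_estimate L (8 * T / 2 ^ k)
        (\<lambda>(h, t, b). if h < L \<and> t < 3 \<and> b < 2 ^ k then \<Sum>v<2 ^ L. of_int (row_coef s v (h, t, b)) * x v else 0) s" for s
      have est: "est (c s) s r = N (s r)" if "r < R" for s r
      proof -
        have "c s (Some (r, i)) = (case i of (h, t, b) \<Rightarrow> if h < L \<and> t < 3 \<and> b < 2 ^ k
            then \<Sum>v<2 ^ L. of_int (row_coef (s r) v (h, t, b)) * x v else 0)" for i
          using that sum_items[OF U, of "\<lambda>v. of_int (row_coef (s r) v i)" \<sigma>]
          by (auto simp: c_def J_def I_def coef_def x_def split: prod.splits)
        then show ?thesis by (simp add: est_def N_def cN)
      qed
      have noisy: "N s h p = noisy s h p" if "s \<in> set_pmf ?D" "h < L" "p < 2 ^ (L - h)" for s h p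
      proof -
        have \<tau>: "8 * T / 2 ^ k = \<tau>" by (simp add: \<tau>_def SS)
        show ?thesis unfolding N_def \<tau> using that by (intro node_estimate_noisy) (auto simp: row_seeds_def)
      qed
      let ?a = "\<epsilon> * T / 2"
      have a0: "?a > 0" using \<epsilon> T0 by simp
      define Bad where "Bad u = {s. \<not> good_path (noisy s) ?a u}" for u
      have bad1: "measure_pmf.prob ?D (Bad u) \<le> 1 / 48" if u: "u < 2 ^ L" for u
      proof -
        have "measure_pmf.prob ?D (Bad u) \<le> 72 * real L * T\<^sup>2 / (w\<^sup>2 * ?a\<^sup>2)"
          using prob_bad_path[OF u a0] T0 SS by (simp add: Bad_def row_seeds_def)
        also have "\<dots> \<le> 1 / 48"
        proof -
          \<comment> \<open>The constant 128 suffices because \<open>72 * 48 * 4 = 13824\<close> is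
            below \<open>128 * 128 = 16384\<close>; the factor 4 comes from the halved error
            \<open>?a\<close>.\<close>
          have "(128 * sqrt L)\<^sup>2 \<le> (w * \<epsilon>)\<^sup>2"
            using k(2) \<epsilon> by (intro power_mono) (auto simp: field_simps)
          then have "16384 * real L \<le> w\<^sup>2 * \<epsilon>\<^sup>2" by (simp add: power_mult_distrib)
          then have "72 * real L * 48 * 4 \<le> w\<^sup>2 * \<epsilon>\<^sup>2" by simp
          then have "72 * real L * 48 * 4 * T\<^sup>2 \<le> w\<^sup>2 * \<epsilon>\<^sup>2 * T\<^sup>2" by (intro mult_right_mono) auto
          then show ?thesis using \<epsilon> T0 by (simp add: field_simps power2_eq_square)
        qed
        finally show ?thesis .
      qed
      have "measure_pmf.prob ?D {s. \<not> (acc q T (N s) a \<and> (\<forall>b. acc q T (N s) b \<longrightarrow> b \<in> G))} \<le> measure_pmf.prob ?D (\<Union>u\<in>Us. Bad u)"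
      proof (rule pmf_prob_mono)
        fix s assume s: "s \<in> set_pmf ?D" "s \<in> {s. \<not> (acc q T (N s) a \<and> (\<forall>b. acc q T (N s) b \<longrightarrow> b \<in> G))}"
        then obtain u where u: "u \<in> Us" "\<not> good_path (N s) ?a u" using ok by blast
        \<comment> \<open>A path inspects only blocks that exist in the tree, and there the decoded
          estimates equal \<open>noisy\<close>.\<close>
        have "good_path (N s) ?a u = good_path (noisy s) ?a u"
          unfolding good_path_def using u(1) Us(3) noisy[OF s(1)]
          by (intro all_cong1 imp_cong refl) (auto simp: mid_point_cong[of u L _ "N s" "noisy s"] subset_iff)
        with u show "s \<in> (\<Union>u\<in>Us. Bad u)" by (auto simp: Bad_def)
      qed
      also have "\<dots> \<le> (\<Sum>u\<in>Us. measure_pmf.prob ?D (Bad u))" using Us(1) by (intro measure_UNION_le) auto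
      also have "\<dots> \<le> (\<Sum>u\<in>Us. 1 / 48)" using Us(3) by (intro sum_mono bad1) auto
      also have "\<dots> \<le> 1 / 16" using Us(2) by simp
      finally have bad: "measure_pmf.prob ?D {s. \<not> (acc q T (N s) a \<and> (\<forall>b. acc q T (N s) b \<longrightarrow> b \<in> G))} \<le> 1 / 16" .
      have "choice q (c s) s = (SOME b. R < 2 * card {r\<in>{..<R}. acc q T (N (s r)) b})" for s
      proof -
        have "{r\<in>{..<R}. acc q T (est (c s) s r) b} = {r\<in>{..<R}. acc q T (N (s r)) b}" for b
          using est by auto
        then show ?thesis by (simp add: choice_def cN)
      qed
      then show ?thesis
        using prob_majority_choice[OF card_row_seeds(1)[OF H B], where acc = "\<lambda>s. acc q T (N s)", OF bad, of R d]
        by (simp add: p_def D_def vimage_def)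
    qed
    then show "\<exists>p. response A \<sigma> q = bind_pmf p (post q (stream_rank \<sigma> U)) \<and> finite (set_pmf p) \<and>
        (\<forall>a G Us. stream_rank \<sigma> U > 0 \<longrightarrow> finite Us \<longrightarrow> card Us \<le> 3 \<longrightarrow> Us \<subseteq> {..<2 ^ L} \<longrightarrow>
          (\<forall>N. (\<forall>u\<in>Us. dyadic.good_path L (items U \<sigma>) N (\<epsilon> * stream_rank \<sigma> U / 2) u) \<longrightarrow>
             acc q (stream_rank \<sigma> U) N a \<and> (\<forall>b. acc q (stream_rank \<sigma> U) N b \<longrightarrow> b \<in> G)) \<longrightarrow>
          measure_pmf.prob p G \<ge> 1 - 1 / 2 ^ R)"
      using r finD unfolding T_def x_def by (intro exI[of _ p]) (auto simp: p_def)
  qed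
qed

section \<open>Approximate rank and approximate quantile\<close>


lemma power_of_two_between:
  fixes t :: real
  assumes "t \<ge> 1"
  shows "\<exists>k. t \<le> 2 ^ k \<and> 2 ^ k \<le> 2 * t"
proof -
  define k where "k = (LEAST k. t \<le> 2 ^ k)"
  have "\<exists>k. t \<le> 2 ^ k" using real_arch_pow[of 2 t] less_imp_le by auto
  then have k: "t \<le> 2 ^ k" unfolding k_def by (rule LeastI_ex)
  have "2 ^ k \<le> 2 * t"
  proof (cases k)
    case (Suc j)
    then have "\<not> t \<le> 2 ^ j" using not_less_Least[of j "\<lambda>k. t \<le> 2 ^ k"] by (simp add: k_def)
    then show ?thesis by (simp add: Suc)
  qed (use assms in simp)
  with k show ?thesis by blast
qed

text \<open>Leaf \<open>Suc U\<close> has to exist, because the rank of \<open>U\<close> is read off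
  as the left end of that leaf.\<close>

lemma universe_exponent:
  assumes "U \<ge> 2"
  shows "\<exists>L. Suc U < 2 ^ L \<and> real (2 ^ L) \<le> 4 * real U \<and> real L \<le> 3 * log 2 (real U) \<and> L > 0"
proof -
  obtain L where L: "real U + 2 \<le> 2 ^ L" "2 ^ L \<le> 2 * (real U + 2)"
    using power_of_two_between[of "real U + 2"] by auto
  have up: "real (2 ^ L) \<le> 4 * real U" using L(2) assms by simp
  have "real (Suc U) < real (2 ^ L)" using L(1) by simp
  then have lo: "Suc U < 2 ^ L" using of_nat_less_iff by blast
  have "real L = log 2 (2 ^ L)" by simp
  also have "\<dots> \<le> log 2 (4 * real U)" using up assms by (intro log_le_cancel_iff[THEN iffD2]) auto
  also have "\<dots> = 2 + log 2 (real U)" using assms log_pow_cancel[of "2::real" 2] by (simp add: log_mult)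
  also have "\<dots> \<le> 3 * log 2 (real U)"
    using assms by simp
  finally have "real L \<le> 3 * log 2 (real U)" .
  moreover have "L > 0" using lo by (cases L) auto
  ultimately show ?thesis using lo up by blast
qed

text \<open>This is the source of the exponent 3 for the word size: \<open>4 \<le> U * U\<close>,
  and a seed word is below \<open>2 ^ L \<le> 4 * U\<close>.\<close>

lemma word_bound:
  assumes "U \<ge> 2" "0 < \<epsilon>" "\<epsilon> < 1"
  shows "4 * real U \<le> (real U / \<epsilon>) powr 3"
proof -
  have "4 * real U \<le> real U * real U * real U" using assms(1) by (intro mult_right_mono) (auto intro: order_trans[OF _ mult_mono[of 2 _ 2]])
  also have "\<dots> = real U powr 3" by (simp add: powr_numeral power3_eq_cube)
  also have "\<dots> \<le> (real U / \<epsilon>) powr 3" using assms by (intro powr_mono2) (auto simp: field_simps)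
  finally show ?thesis .
qed

text \<open>Since \<open>3 * k + 1 \<le> 3 * 2 ^ k\<close>, seeds and counters together take at most
  \<open>7 * 2 ^ k * L * R\<close> words. Rounding the width to a power of two gives
  \<open>2 ^ k \<le> 256 * sqrt L / e\<close>, and \<open>L \<le> 3 * log 2 U\<close> costs another
  \<open>3 powr (3/2) \<le> 6\<close>; finally \<open>7 * 256 * 6 = 10752\<close>.\<close>

lemma sketch_size:
  assumes U: "U \<ge> 2" and e: "0 < e" "e \<le> 1"
  shows "\<exists>L k. Suc U < 2 ^ L \<and> real (2 ^ L) \<le> 4 * real U \<and> k > 0 \<and> 128 * sqrt L / e \<le> 2 ^ k \<and>
    (\<forall>R>0. real ((3 * k + 1) * L * R + Suc (R * (L * (3 * 2 ^ k)))) \<le> 11000 * real R * log 2 (real U) powr (3/2) / e)"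
proof -
  let ?l = "log 2 (real U)"
  obtain L where L: "Suc U < 2 ^ L" "real (2 ^ L) \<le> 4 * real U" "real L \<le> 3 * ?l" "L > 0"
    using universe_exponent[OF U] by blast
  have l1: "?l \<ge> 1" using U by simp
  let ?t = "128 * sqrt L / e"
  have "1 \<le> sqrt L" using L(4) by simp
  then have "128 * 1 / 1 \<le> ?t" using e by (intro frac_le mult_left_mono) auto
  then have t: "?t \<ge> 128" by simp
  then obtain k where k: "?t \<le> 2 ^ k" "2 ^ k \<le> 2 * ?t" using power_of_two_between[of ?t] by auto
  have k0: "k > 0" using k(1) t by (cases k) auto
  have "real ((3 * k + 1) * L * R + Suc (R * (L * (3 * 2 ^ k)))) \<le> 11000 * real R * ?l powr (3/2) / e" if R: "R > 0" for R
  proof -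
    have "Suc k \<le> 2 ^ k" by (simp add: Suc_leI)
    then have "(3 * k + 1) * L * R \<le> 3 * 2 ^ k * L * R" by (intro mult_right_mono) auto
    moreover have "1 \<le> 2 ^ k * L * R" using L(4) R by (simp add: Suc_le_eq)
    ultimately have size: "(3 * k + 1) * L * R + Suc (R * (L * (3 * 2 ^ k))) \<le> 7 * (2 ^ k * L * R)"
    proof -
      have "R * (L * (3 * 2 ^ k)) = 3 * (2 ^ k * L * R)" "3 * 2 ^ k * L * R = 3 * (2 ^ k * L * R)" by simp_all
      with \<open>1 \<le> 2 ^ k * L * R\<close> \<open>(3 * k + 1) * L * R \<le> 3 * 2 ^ k * L * R\<close> show ?thesis by linarith
    qed
    have "real ((3 * k + 1) * L * R + Suc (R * (L * (3 * 2 ^ k)))) \<le> 7 * (2 ^ k * real L * real R)"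
      using of_nat_mono[OF size, where 'a = real] by simp
    also have "\<dots> \<le> 7 * (2 * ?t * L * R)" using k(2) by (intro mult_left_mono mult_right_mono) auto
    also have "\<dots> = 1792 * (sqrt L * L) * R / e" by simp
    also have "sqrt L * L = real L powr (3/2)"
      using L(4) powr_add[of "real L" "1/2" 1] by (simp add: powr_half_sqrt)
    also have "real L powr (3/2) \<le> (3 * ?l) powr (3/2)" using L(3) by (intro powr_mono2) auto
    also have "(3 * ?l) powr (3/2) = 3 powr (3/2) * ?l powr (3/2)" using l1 by (simp add: powr_mult)
    also have "3 powr (3/2) \<le> (6::real)"
    proof -
      have "3 powr (3/2) = 3 * sqrt (3::real)" using powr_add[of "3::real" "1/2" 1] by (simp add: powr_half_sqrt)
      moreover have "sqrt 3 \<le> (2::real)" by (rule real_le_lsqrt) auto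
      ultimately show ?thesis by simp
    qed
    finally have "real ((3 * k + 1) * L * R + Suc (R * (L * (3 * 2 ^ k)))) \<le> 1792 * (6 * ?l powr (3/2)) * R / e"
      using e by (simp add: divide_right_mono mult_right_mono mult_left_mono)
    also have "\<dots> \<le> 11000 * real R * ?l powr (3/2) / e" using e by (intro divide_right_mono) auto
    finally show ?thesis .
  qed
  with L k k0 show ?thesis by blast
qed

section \<open>The norm counter and random shifts of an estimate\<close>

lemma norm_counter_alg:
  fixes f :: "'q \<Rightarrow> real \<Rightarrow> 'a pmf"
  assumes "W \<ge> 1"
  shows "\<exists>A. memory_size A = 1 \<and> runs_in_memory W A \<and>
    (\<forall>\<sigma> q. strict_turnstile U \<sigma> \<longrightarrow> response A \<sigma> q = f q (stream_rank \<sigma> U))"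
proof -
  obtain A where A: "memory_size A = 1" "runs_in_memory W A"
    and resp: "\<And>\<sigma> V q. finite V \<Longrightarrow> fst ` set \<sigma> \<subseteq> V \<Longrightarrow>
      response A \<sigma> q = bind_pmf (return_pmf ()) (\<lambda>s. f q (\<Sum>v\<in>V. stream_vec \<sigma> v))"
    using linear_sketch[of "return_pmf ()" 1 0 W "{()}" "\<lambda>_ _ _. 1" "\<lambda>q _ c. f q (c ())"] assms by auto
  show ?thesis
    using A resp[of "{1..U}"] by (intro exI[of _ A]) (auto simp: strict_turnstile_def stream_rank_def bind_return_pmf)
qed

text \<open>The possible results are the centres of \<open>K\<close> adjacent intervals of
  half-width \<open>e * T\<close>, the first of which starts at \<open>b - e' * T\<close>. If
  \<open>e' \<le> K * e\<close>, they cover everything within \<open>e' * T\<close> of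
  \<open>b\<close>.\<close>

definition grid_shift :: "nat \<Rightarrow> real \<Rightarrow> real \<Rightarrow> real \<Rightarrow> real \<Rightarrow> real pmf" where
  "grid_shift K e e' T b = map_pmf (\<lambda>i. b + (2 * real i * e + e - e') * T) (pmf_of_set {..<K})"

lemma finite_grid_shift: "K > 0 \<Longrightarrow> finite (set_pmf (grid_shift K e e' T b))"
  by (simp add: grid_shift_def lessThan_empty_iff)

lemma grid_shift_hits:
  assumes K: "K > 0" "e' \<le> real K * e" and e: "e > 0" and T: "T > 0" and b: "\<bar>b - \<rho>\<bar> \<le> e' * T"
  shows "measure_pmf.prob (grid_shift K e e' T b) {r. \<bar>r - \<rho>\<bar> \<le> e * T} \<ge> 1 / real K"
proof -
  define d where "d = (\<rho> - b) / T"
  have d: "0 \<le> d + e'" "d + e' \<le> 2 * e'" using b T by (auto simp: d_def field_simps abs_le_iff)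
  \<comment> \<open>The cap at \<open>K - 1\<close> matters only at the right end of the covered
    range, where the floor equals \<open>K\<close>.\<close>
  define i where "i = min (K - 1) (nat \<lfloor>(d + e') / (2 * e)\<rfloor>)"
  have "\<bar>2 * real i * e + e - e' - d\<bar> \<le> e"
  proof (cases "nat \<lfloor>(d + e') / (2 * e)\<rfloor> \<le> K - 1")
    case True
    then have "real i = of_int \<lfloor>(d + e') / (2 * e)\<rfloor>" using d e by (simp add: i_def)
    then have "real i \<le> (d + e') / (2 * e)" "(d + e') / (2 * e) < real i + 1" by linarith+
    then have "2 * real i * e \<le> d + e'" "d + e' < 2 * real i * e + 2 * e" using e by (simp_all add: field_simps)
    then show ?thesis by linarith
  next
    case False
    then have i: "real i = real K - 1" "real K \<le> of_int \<lfloor>(d + e') / (2 * e)\<rfloor>" using K(1) by (auto simp: i_def)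
    then have "real K \<le> (d + e') / (2 * e)" by linarith
    then have "2 * (real K * e) \<le> d + e'" using e by (simp add: field_simps)
    moreover have "2 * real i * e = 2 * (real K * e) - 2 * e" by (simp add: i algebra_simps)
    ultimately show ?thesis using d K(2) e by linarith
  qed
  then have "\<bar>2 * real i * e + e - e' - d\<bar> * T \<le> e * T" using T by (intro mult_right_mono) auto
  moreover have "\<bar>2 * real i * e + e - e' - d\<bar> * T = \<bar>b + (2 * real i * e + e - e') * T - \<rho>\<bar>"
  proof -
    have "(2 * real i * e + e - e' - d) * T = b + (2 * real i * e + e - e') * T - \<rho>"
      using T by (simp add: d_def field_simps)
    then show ?thesis using T by (metis abs_mult abs_of_pos)
  qed
  ultimately have hit: "\<bar>b + (2 * real i * e + e - e') * T - \<rho>\<bar> \<le> e * T" by simp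
  have iK: "i < K" using K(1) by (auto simp: i_def)
  have "1 / real K = measure_pmf.prob (pmf_of_set {..<K}) {i}"
    using K(1) iK by (simp add: measure_pmf_single lessThan_empty_iff)
  also have "\<dots> \<le> measure_pmf.prob (pmf_of_set {..<K}) {i. \<bar>b + (2 * real i * e + e - e') * T - \<rho>\<bar> \<le> e * T}"
    using hit by (intro measure_pmf.finite_measure_mono) auto
  finally show ?thesis by (simp add: grid_shift_def vimage_def)
qed

lemma prob_bind_ge:
  assumes "finite (set_pmf p)" "\<And>x. finite (set_pmf (f x))" "\<And>x. x \<in> G \<Longrightarrow> measure_pmf.prob (f x) Y \<ge> c"
  shows "measure_pmf.prob (bind_pmf p f) Y \<ge> c * measure_pmf.prob p G"
proof -
  have "c * measure_pmf.prob p G = pexp p (\<lambda>x. c * indicat_real G x)" by simp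
  also have "\<dots> \<le> pexp p (\<lambda>x. measure_pmf.prob (f x) Y)"
    using assms by (intro pexp_mono) (auto simp: indicator_def)
  also have "\<dots> = measure_pmf.prob (bind_pmf p f) Y" using assms by (subst prob_bind) auto
  finally show ?thesis .
qed

section \<open>Approximate rank\<close>

lemma stream_rank_mono:
  assumes "strict_turnstile U \<sigma>" "u \<le> v" "v \<le> U"
  shows "stream_rank \<sigma> u \<le> stream_rank \<sigma> v"
  unfolding stream_rank_def using assms by (intro sum_mono2) (auto intro!: stream_vec_nonneg[OF assms(1)])

lemma stream_rank_nonneg: "strict_turnstile U \<sigma> \<Longrightarrow> u \<le> U \<Longrightarrow> stream_rank \<sigma> u \<ge> 0"
  using stream_rank_mono[of U \<sigma> 0 u] by (simp add: stream_rank_def)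

lemma stream_rank_le_size: "strict_turnstile U \<sigma> \<Longrightarrow> stream_rank \<sigma> U \<le> real (stream_size U \<sigma>)"
  by (simp add: stream_size_eq)

lemma rank_answers_superset:
  assumes "strict_turnstile U \<sigma>" "\<epsilon> \<ge> 0"
  shows "{r. \<bar>r - stream_rank \<sigma> u\<bar> \<le> \<epsilon> * stream_rank \<sigma> U} \<subseteq> rank_answers \<epsilon> U \<sigma> u"
  using mult_left_mono[OF stream_rank_le_size[OF assms(1)] assms(2)] by (auto simp: rank_answers_def)

text \<open>The sketch runs with its own error \<open>e\<close>, which may exceed
  \<open>\<epsilon>\<close>; a random one of \<open>K\<close> shifts then reaches error
  \<open>\<epsilon>\<close> with probability at least \<open>1 / K\<close>. For \<open>K = 1\<close>
  and \<open>e = \<epsilon>\<close> the shift is 0.\<close>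

lemma AR_from_sketch:
  assumes U: "U \<ge> 2" and \<epsilon>: "0 < \<epsilon>" "\<epsilon> < 1" and e: "0 < e" "e \<le> 1" and R: "R > 0" and K: "K > 0" "e \<le> real K * \<epsilon>"
    and prob: "1 - \<delta> \<le> (1 - 1 / 2 ^ R) / real K" and \<delta>: "\<delta> > 0"
  shows "\<exists>A. runs_in_memory ((real U / \<epsilon>) powr 3) A \<and>
           real (memory_size A) \<le> 11000 * real R * log 2 (real U) powr (3/2) / e \<and> solves_AR \<epsilon> \<delta> U A"
proof -
  obtain L k where L: "Suc U < 2 ^ L" "real (2 ^ L) \<le> 4 * real U" and k: "k > 0" "128 * sqrt L / e \<le> 2 ^ k"
    and mem: "real ((3 * k + 1) * L * R + Suc (R * (L * (3 * 2 ^ k)))) \<le> 11000 * real R * log 2 (real U) powr (3/2) / e"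
    using sketch_size[OF U e] R by blast
  \<comment> \<open>With tolerance \<open>e * T / 2\<close>, an accurate copy accepts the true rank,
    and by the triangle inequality everything it accepts is within \<open>e * T\<close> of that
    rank.\<close>
  define acc where "acc u T N b \<longleftrightarrow> \<bar>left_end L N (Suc u) 0 - b\<bar> \<le> e * T / 2"
    for u :: nat and T :: real and N and b :: real
  define post where "post u T b = (if T = 0 then return_pmf 0 else grid_shift K \<epsilon> e T b)" for u :: nat and T b :: real
  have UL: "U < 2 ^ L" and W: "2 ^ L \<le> (real U / \<epsilon>) powr 3" using L word_bound[OF U \<epsilon>] by auto
  obtain A where A: "memory_size A = (3 * k + 1) * L * R + Suc (R * (L * (3 * 2 ^ k)))" "runs_in_memory ((real U / \<epsilon>) powr 3) A"
    and resp: "\<And>\<sigma> q. strict_turnstile U \<sigma> \<Longrightarrow>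
      (\<exists>p. response A \<sigma> q = bind_pmf p (post q (stream_rank \<sigma> U)) \<and> finite (set_pmf p) \<and>
        (\<forall>a G Us. stream_rank \<sigma> U > 0 \<longrightarrow> finite Us \<longrightarrow> card Us \<le> 3 \<longrightarrow> Us \<subseteq> {..<2 ^ L} \<longrightarrow>
          (\<forall>N. (\<forall>u\<in>Us. dyadic.good_path L (items U \<sigma>) N (e * stream_rank \<sigma> U / 2) u) \<longrightarrow>
             acc q (stream_rank \<sigma> U) N a \<and> (\<forall>b. acc q (stream_rank \<sigma> U) N b \<longrightarrow> b \<in> G)) \<longrightarrow>
          measure_pmf.prob p G \<ge> 1 - 1 / 2 ^ R))"
    using amplified_sketch[OF UL W e(1) k, where R = R and acc = acc and post = post] by blast
  have "measure_pmf.prob (response A \<sigma> u) (rank_answers \<epsilon> U \<sigma> u) \<ge> 1 - \<delta>"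
    if \<sigma>: "strict_turnstile U \<sigma>" and u: "u \<in> {1..U}" for \<sigma> u
  proof -
    let ?T = "stream_rank \<sigma> U" and ?\<rho> = "stream_rank \<sigma> u"
    obtain p where p: "response A \<sigma> u = bind_pmf p (post u ?T)" "finite (set_pmf p)"
      and good: "\<And>a G Us. ?T > 0 \<Longrightarrow> finite Us \<Longrightarrow> card Us \<le> 3 \<Longrightarrow> Us \<subseteq> {..<2 ^ L} \<Longrightarrow>
          (\<And>N. (\<forall>u\<in>Us. dyadic.good_path L (items U \<sigma>) N (e * ?T / 2) u) \<Longrightarrow>
             acc u ?T N a \<and> (\<forall>b. acc u ?T N b \<longrightarrow> b \<in> G)) \<Longrightarrow>
          measure_pmf.prob p G \<ge> 1 - 1 / 2 ^ R"
      using resp[OF \<sigma>, of u] by (elim exE conjE) metis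
    show ?thesis
    proof (cases "?T = 0")
      case True
      then have post0: "post u ?T = (\<lambda>_. return_pmf 0)" by (simp add: post_def fun_eq_iff)
      have "?\<rho> = 0" using True stream_rank_mono[OF \<sigma>, of u U] stream_rank_nonneg[OF \<sigma>, of u] u by simp
      then have "0 \<in> rank_answers \<epsilon> U \<sigma> u" using \<epsilon> by (simp add: rank_answers_def)
      then show ?thesis using \<delta> by (simp add: p(1) post0)
    next
      case False
      then have T: "?T > 0" using stream_rank_nonneg[OF \<sigma>, of U] by simp
      interpret dyadic L "items U \<sigma>" by (rule items_dyadic[OF \<sigma>])
      let ?G = "{b. \<bar>b - ?\<rho>\<bar> \<le> e * ?T}"
      have "measure_pmf.prob p ?G \<ge> 1 - 1 / 2 ^ R"
      proof (rule good[OF T, of "{Suc u}" ?\<rho>])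
        fix N assume "\<forall>v\<in>{Suc u}. good_path N (e * ?T / 2) v"
        then have "\<bar>left_end L N (Suc u) 0 - prefix_sum (Suc u)\<bar> \<le> e * ?T / 2"
          using good_path_left_end[of N "e * ?T / 2" "Suc u"] L(1) u e T by simp
        then have "\<bar>left_end L N (Suc u) 0 - ?\<rho>\<bar> \<le> e * ?T / 2" using prefix_sum_items[OF \<sigma>, of u] u by simp
        moreover have "b \<in> ?G" if "acc u ?T N b" for b 
          using calculation that unfolding acc_def abs_le_iff mem_Collect_eq by linarith
        ultimately show "acc u ?T N ?\<rho> \<and> (\<forall>b. acc u ?T N b \<longrightarrow> b \<in> ?G)" unfolding acc_def by blast
      qed (use L(1) u in auto)
      then have "(1 - 1 / 2 ^ R) / real K \<le> measure_pmf.prob p ?G / real K" by (intro divide_right_mono) auto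
      then have "1 - \<delta> \<le> 1 / real K * measure_pmf.prob p ?G" using prob by simp
      also have "\<dots> \<le> measure_pmf.prob (bind_pmf p (post u ?T)) {r. \<bar>r - ?\<rho>\<bar> \<le> \<epsilon> * ?T}"
        using p(2) T K \<epsilon>(1)
        by (intro prob_bind_ge) (auto simp: post_def finite_grid_shift intro!: grid_shift_hits)
      also have "\<dots> \<le> measure_pmf.prob (response A \<sigma> u) (rank_answers \<epsilon> U \<sigma> u)"
        unfolding p(1) using rank_answers_superset[OF \<sigma>, of \<epsilon> u] \<epsilon> by (intro measure_pmf.finite_measure_mono) auto
      finally show ?thesis .
    qed
  qed
  then have "solves_AR \<epsilon> \<delta> U A" unfolding solves_AR_def by blast
  then show ?thesis using A mem by (intro exI[of _ A]) simp
qed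

text \<open>Ranks lie between 0 and the norm, so half the norm is off by at most half the norm, and
  \<open>K < 1 / (2 * \<epsilon>) + 1\<close> shifts cover this range. A random shift is right with
  probability at least \<open>1 / K\<close>, which exceeds \<open>\<epsilon> / 4\<close>.\<close>

lemma AR_from_norm:
  assumes U: "U \<ge> 2" and \<epsilon>: "0 < \<epsilon>" "\<epsilon> < 1" and \<delta>: "1 - \<delta> \<le> \<epsilon> / 4" "\<delta> > 0"
  shows "\<exists>A. runs_in_memory ((real U / \<epsilon>) powr 3) A \<and> memory_size A = 1 \<and> solves_AR \<epsilon> \<delta> U A"
proof -
  define K where "K = nat \<lceil>1 / (2 * \<epsilon>)\<rceil>"
  have K: "1 / (2 * \<epsilon>) \<le> real K" "real K < 1 / (2 * \<epsilon>) + 1" "K > 0" using \<epsilon> by (auto simp: K_def) linarith+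
  then have Ke: "1 / 2 \<le> real K * \<epsilon>" "real K * \<epsilon> < 1 / 2 + \<epsilon>" using \<epsilon>(1) by (simp_all add: field_simps)
  have W: "(real U / \<epsilon>) powr 3 \<ge> 1" using word_bound[OF U \<epsilon>] U by simp
  obtain A where A: "memory_size A = 1" "runs_in_memory ((real U / \<epsilon>) powr 3) A"
    and resp: "\<And>\<sigma> (q::nat). strict_turnstile U \<sigma> \<Longrightarrow> response A \<sigma> q =
       (if stream_rank \<sigma> U = 0 then return_pmf 0 else grid_shift K \<epsilon> (1/2) (stream_rank \<sigma> U) (stream_rank \<sigma> U / 2))"
    using norm_counter_alg[OF W, where f = "\<lambda>(q::nat) T. if T = 0 then return_pmf 0 else grid_shift K \<epsilon> (1/2) T (T / 2)" and U = U] by auto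
  have "measure_pmf.prob (response A \<sigma> u) (rank_answers \<epsilon> U \<sigma> u) \<ge> 1 - \<delta>"
    if \<sigma>: "strict_turnstile U \<sigma>" and u: "u \<in> {1..U}" for \<sigma> u
  proof -
    let ?T = "stream_rank \<sigma> U" and ?\<rho> = "stream_rank \<sigma> u"
    have \<rho>: "0 \<le> ?\<rho>" "?\<rho> \<le> ?T" using stream_rank_mono[OF \<sigma>, of u U] stream_rank_nonneg[OF \<sigma>, of u] u by auto
    show ?thesis
    proof (cases "?T = 0")
      case True
      then have "0 \<in> rank_answers \<epsilon> U \<sigma> u" using \<epsilon> \<rho> by (simp add: rank_answers_def)
      then show ?thesis using True \<delta> by (simp add: resp[OF \<sigma>])
    next
      case False
      then have T: "?T > 0" using \<rho> by simp
      have half: "\<bar>?T / 2 - ?\<rho>\<bar> \<le> 1 / 2 * ?T" using \<rho> by linarith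
      have "1 - \<delta> \<le> 1 / real K"
      proof -
        have "(1 - \<delta>) * real K \<le> \<epsilon> / 4 * real K" using \<delta> by (intro mult_right_mono) auto
        also have "\<dots> = real K * \<epsilon> / 4" by simp
        also have "\<dots> \<le> 1" using Ke(2) \<epsilon> by linarith
        finally show ?thesis using K(3) by (simp add: field_simps)
      qed
      also have "\<dots> \<le> measure_pmf.prob (grid_shift K \<epsilon> (1/2) ?T (?T / 2)) {r. \<bar>r - ?\<rho>\<bar> \<le> \<epsilon> * ?T}"
        using K Ke \<epsilon> T half by (intro grid_shift_hits) auto
      also have "\<dots> \<le> measure_pmf.prob (response A \<sigma> u) (rank_answers \<epsilon> U \<sigma> u)"
        using False rank_answers_superset[OF \<sigma>, of \<epsilon> u] \<epsilon> resp[OF \<sigma>]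
        by (simp add: measure_pmf.finite_measure_mono)
      finally show ?thesis .
    qed
  qed
  then have "solves_AR \<epsilon> \<delta> U A" unfolding solves_AR_def by blast
  then show ?thesis using A by blast
qed

text \<open>From \<open>ln \<delta> \<le> \<delta> - 1\<close> and \<open>ln 2 \<le> 1\<close>. It
  turns a memory bound proportional to \<open>1 - \<delta>\<close> into the required one when
  \<open>\<delta>\<close> is near 1.\<close>

lemma one_minus_le_log: "0 < \<delta> \<Longrightarrow> \<delta> < 1 \<Longrightarrow> 1 - \<delta> \<le> log 2 (1 / \<delta>)"
proof -
  assume \<delta>: "0 < \<delta>" "\<delta> < 1"
  have "1 - \<delta> \<le> ln (1 / \<delta>)" using \<delta> ln_le_minus_one[of \<delta>] by (simp add: ln_div)
  also have "\<dots> \<le> ln (1 / \<delta>) / ln 2"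
  proof -
    have "ln (1 / \<delta>) * ln 2 \<le> ln (1 / \<delta>) * 1"
      using \<delta> ln2_le_25_over_36 by (intro mult_left_mono) auto
    then show ?thesis by (simp add: pos_le_divide_eq)
  qed
  finally show ?thesis by (simp add: log_def)
qed

lemma repetitions:
  assumes "0 < \<delta>" "\<delta> < 1"
  shows "\<exists>R>0. 1 - \<delta> \<le> 1 - 1 / 2 ^ R \<and> real R \<le> log 2 (1 / \<delta>) + 1"
proof -
  define R where "R = nat \<lceil>log 2 (1 / \<delta>)\<rceil>"
  have l: "log 2 (1 / \<delta>) > 0" using assms by (simp add: zero_less_log_cancel_iff)
  then have R: "log 2 (1 / \<delta>) \<le> real R" "real R \<le> log 2 (1 / \<delta>) + 1" "R > 0" by (auto simp: R_def)
  have "1 / \<delta> = 2 powr log 2 (1 / \<delta>)" using assms by simp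
  also have "\<dots> \<le> 2 powr real R" using R(1) by simp
  also have "\<dots> = 2 ^ R" by (simp add: powr_realpow)
  finally have "1 / 2 ^ R \<le> \<delta>" using assms by (simp add: field_simps)
  with R show ?thesis by auto
qed

lemma AR_exists:
  assumes U: "U \<ge> 2" and \<epsilon>: "0 < \<epsilon>" "\<epsilon> < 1" and \<delta>: "0 < \<delta>" "\<delta> < 1"
  shows "\<exists>A. runs_in_memory ((real U / \<epsilon>) powr 3) A \<and>
     int (memory_size A) \<le> \<lceil>44000 * (log 2 (real U) powr (3/2) * log 2 (1 / \<delta>) / \<epsilon>)\<rceil> \<and> solves_AR \<epsilon> \<delta> U A"
proof -
  let ?l = "log 2 (real U) powr (3/2)" and ?D = "log 2 (1 / \<delta>)"
  have D: "?D > 0" using \<delta> by (simp add: zero_less_log_cancel_iff)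
  have "log 2 (real U) \<ge> 1" using U by simp
  then have l: "?l > 0" by simp
  have ceil: "int m \<le> \<lceil>z\<rceil>" if "real m \<le> z" for m z
    using that by linarith
  consider "\<delta> < 3/4" | "\<delta> \<ge> 3/4" "4 * (1 - \<delta>) \<ge> \<epsilon>" | "4 * (1 - \<delta>) < \<epsilon>" by linarith
  then show ?thesis
  proof cases
    case 1
    obtain R where R: "R > 0" "1 - \<delta> \<le> 1 - 1 / 2 ^ R" "real R \<le> ?D + 1" using repetitions[OF \<delta>] by blast
    \<comment> \<open>This absorbs the rounding of \<open>R\<close> into the factor 4 of
      \<open>R \<le> 4 * ?D\<close>; it holds since \<open>(4/3) ^ 3 = 64/27\<close> exceeds
      2.\<close>
    have "1 / 3 \<le> ?D"
    proof -
      have "2 \<le> (1 / \<delta>) ^ 3"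
      proof -
        have "(4/3) ^ 3 \<le> (1 / \<delta>) ^ 3" using 1 \<delta> by (intro power_mono) (auto simp: field_simps)
        then show ?thesis by (simp add: power3_eq_cube)
      qed
      then have "log 2 2 \<le> log 2 ((1 / \<delta>) ^ 3)" using \<delta> by (intro log_le_cancel_iff[THEN iffD2]) auto
      then show ?thesis using \<delta> by (simp add: log_nat_power)
    qed
    then have R4: "real R \<le> 4 * ?D" using R(3) by simp
    obtain A where A: "runs_in_memory ((real U / \<epsilon>) powr 3) A"
      "real (memory_size A) \<le> 11000 * real R * ?l / \<epsilon>" "solves_AR \<epsilon> \<delta> U A"
      using AR_from_sketch[OF U \<epsilon> \<epsilon>(1) _ R(1), of 1 \<delta>] \<epsilon> \<delta> R by auto
    note A(2)
    also have "11000 * real R * ?l / \<epsilon> \<le> 11000 * (4 * ?D) * ?l / \<epsilon>"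
      using R4 \<epsilon> l by (intro divide_right_mono mult_right_mono mult_left_mono) auto
    finally show ?thesis using A by (intro exI[of _ A] conjI ceil) (auto simp: mult_ac)
  next
    case 2
    \<comment> \<open>A single copy succeeds with probability at least 1/2, and the enlarged error
      multiplies its memory by \<open>4 * (1 - \<delta>)\<close>. The assumption
      \<open>\<delta> \<ge> 3/4\<close> keeps \<open>K * (1 - \<delta>)\<close> at most 1/2.\<close>
    define e where "e = \<epsilon> / (4 * (1 - \<delta>))"
    define K where "K = nat \<lceil>1 / (4 * (1 - \<delta>))\<rceil>"
    have e: "0 < e" "e \<le> 1" using 2 \<epsilon> \<delta> by (auto simp: e_def)
    have K: "1 / (4 * (1 - \<delta>)) \<le> real K" "real K < 1 / (4 * (1 - \<delta>)) + 1" "K > 0"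
      using \<delta> by (auto simp: K_def) linarith+
    have "e \<le> real K * \<epsilon>" using mult_right_mono[OF K(1), of \<epsilon>] \<epsilon> by (simp add: e_def)
    moreover have "1 - \<delta> \<le> (1 - 1 / 2 ^ 1) / real K"
    proof -
      have "(1 - \<delta>) * real K \<le> (1 - \<delta>) * (1 / (4 * (1 - \<delta>)) + 1)" using K(2) \<delta> by (intro mult_left_mono) auto
      also have "\<dots> = 1 / 4 + (1 - \<delta>)" using \<delta> by (simp add: distrib_left)
      also have "\<dots> \<le> 1 / 2" using 2 by simp
      finally show ?thesis using K(3) by (simp add: field_simps)
    qed
    ultimately obtain A where A: "runs_in_memory ((real U / \<epsilon>) powr 3) A"
      "real (memory_size A) \<le> 11000 * real 1 * ?l / e" "solves_AR \<epsilon> \<delta> U A"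
      using AR_from_sketch[OF U \<epsilon> e zero_less_one K(3), of \<delta>] \<delta> by auto
    note A(2)
    also have "11000 * real 1 * ?l / e = 44000 * (?l * (1 - \<delta>) / \<epsilon>)" by (simp add: e_def)
    also have "\<dots> \<le> 44000 * (?l * ?D / \<epsilon>)"
      using one_minus_le_log[OF \<delta>] \<epsilon> l by (intro divide_right_mono mult_left_mono) auto
    finally show ?thesis using A by (intro exI[of _ A] conjI ceil) auto
  next
    case 3
    then obtain A where A: "runs_in_memory ((real U / \<epsilon>) powr 3) A" "memory_size A = 1" "solves_AR \<epsilon> \<delta> U A"
      using AR_from_norm[OF U \<epsilon>, of \<delta>] \<delta> by auto
    \<comment> \<open>The ceiling of a positive bound leaves room for the one counter.\<close>
    have "0 < 44000 * (?l * ?D / \<epsilon>)" using l D \<epsilon> by simp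
    then have "1 \<le> \<lceil>44000 * (?l * ?D / \<epsilon>)\<rceil>" by linarith
    then show ?thesis using A by auto
  qed
qed

section \<open>Approximate quantile\<close>

lemma top_answers_quantile:
  assumes \<sigma>: "strict_turnstile U \<sigma>" and U: "U \<ge> 1" and \<epsilon>: "\<epsilon> \<ge> 0"
    and ne: "quantile_answers \<epsilon> U \<sigma> q \<noteq> {}" and q: "stream_rank \<sigma> U \<le> real q + \<epsilon> * real (stream_size U \<sigma>)"
  shows "U \<in> quantile_answers \<epsilon> U \<sigma> q"
  \<comment> \<open>Index \<open>U\<close> has the largest rank, so it meets the lower requirement
    as soon as any index does.\<close>
  using ne q U stream_rank_mono[OF \<sigma>, of "U - 1" U]
  unfolding quantile_answers_nonempty_iff[OF \<sigma> U \<epsilon>] by (simp add: quantile_answers_def)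

text \<open>If \<open>q \<le> \<epsilon> * n\<close>, both requirements on index 1 are trivial.
  Otherwise \<open>q + \<epsilon> * n > 2 * \<epsilon> * n \<ge> n\<close>, so the upper requirement
  is trivial and \<open>U\<close> is an answer.\<close>

lemma AQ_from_norm:
  assumes U: "U \<ge> 2" and \<epsilon>: "1/2 \<le> \<epsilon>" "\<epsilon> < 1" and \<delta>: "\<delta> > 0"
  shows "\<exists>A. runs_in_memory ((real U / \<epsilon>) powr 3) A \<and> memory_size A = 1 \<and> solves_AQ \<epsilon> \<delta> U A"
proof -
  have W: "(real U / \<epsilon>) powr 3 \<ge> 1" using word_bound[OF U] \<epsilon> U by fastforce
  obtain A where A: "memory_size A = 1" "runs_in_memory ((real U / \<epsilon>) powr 3) A"
    and resp: "\<And>\<sigma> q. strict_turnstile U \<sigma> \<Longrightarrow> response A \<sigma> q =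
       return_pmf (if real q \<le> \<epsilon> * of_int \<lceil>stream_rank \<sigma> U\<rceil> then 1 else U)"
    using norm_counter_alg[OF W, where f = "\<lambda>q T. return_pmf (if real q \<le> \<epsilon> * of_int \<lceil>T\<rceil> then 1 else U)" and U = U] by auto
  have "measure_pmf.prob (response A \<sigma> q) (quantile_answers \<epsilon> U \<sigma> q) \<ge> 1 - \<delta>"
    if \<sigma>: "strict_turnstile U \<sigma>" and ne: "quantile_answers \<epsilon> U \<sigma> q \<noteq> {}" for \<sigma> q
  proof -
    let ?n = "real (stream_size U \<sigma>)"
    have n: "of_int \<lceil>stream_rank \<sigma> U\<rceil> = ?n" using stream_size_eq[OF \<sigma>] by simp
    have "(if real q \<le> \<epsilon> * ?n then 1 else U) \<in> quantile_answers \<epsilon> U \<sigma> q"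
    proof (cases "real q \<le> \<epsilon> * ?n")
      case True
      have "0 \<le> \<epsilon> * ?n" using \<epsilon> by simp
      then show ?thesis using True U stream_rank_nonneg[OF \<sigma>, of 1]
        by (simp add: quantile_answers_def stream_rank_def)
    next
      case False
      have "1/2 * ?n \<le> \<epsilon> * ?n" using \<epsilon> by (intro mult_right_mono) auto
      then have "stream_rank \<sigma> U \<le> real q + \<epsilon> * ?n" using False stream_rank_le_size[OF \<sigma>] by linarith
      then show ?thesis using False top_answers_quantile[OF \<sigma> _ _ ne] U \<epsilon> by simp
    qed
    then show ?thesis using \<delta> by (simp add: resp[OF \<sigma>] n)
  qed
  then have "solves_AQ \<epsilon> \<delta> U A" unfolding solves_AQ_def by blast
  then show ?thesis using A by blast
qed

text \<open>This and the next lemma differ in which side is strict, matching the hypotheses of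
  \<open>good_path_rejects_below\<close> and \<open>good_path_rejects_above\<close>.\<close>

lemma (in dyadic) prefix_sum_crossing:
  assumes "0 < \<theta>" "\<theta> \<le> prefix_sum m"
  shows "\<exists>u<m. prefix_sum u < \<theta> \<and> \<theta> \<le> prefix_sum (Suc u)"
proof -
  have "\<not> \<theta> \<le> prefix_sum 0" using assms(1) by (simp add: prefix_sum_def)
  from ex_least_nat_less[of "\<lambda>u. \<theta> \<le> prefix_sum u", OF assms(2) this]
  obtain u where "u < m" "\<forall>i\<le>u. \<not> \<theta> \<le> prefix_sum i" "\<theta> \<le> prefix_sum (Suc u)" by blast
  then show ?thesis by (intro exI[of _ u]) auto
qed

lemma (in dyadic) prefix_sum_crossing_strict:
  assumes "0 \<le> \<theta>" "\<theta> < prefix_sum m"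
  shows "\<exists>u<m. prefix_sum u \<le> \<theta> \<and> \<theta> < prefix_sum (Suc u)"
proof -
  have "\<not> \<theta> < prefix_sum 0" using assms(1) by (simp add: prefix_sum_def)
  from ex_least_nat_less[of "\<lambda>u. \<theta> < prefix_sum u", OF assms(2) this]
  obtain u where "u < m" "\<forall>i\<le>u. \<not> \<theta> < prefix_sum i" "\<theta> < prefix_sum (Suc u)" by blast
  then show ?thesis by (intro exI[of _ u]) (auto simp: not_less)
qed

text \<open>The set \<open>Us\<close> contains the leaf \<open>c\<close> of \<open>q\<close>, which
  gets accepted, and the leaves of \<open>q - 2 * a\<close> and \<open>q + 2 * a\<close>, which
  fence off everything beyond them. An outer leaf is left out (\<open>V\<close> or \<open>V'\<close>
  empty) when its target is not positive or not below the total weight, since the bound is then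
  trivial.\<close>

lemma (in dyadic) quantile_witnesses:
  assumes m: "m \<le> 2 ^ L" and q: "0 < q" "q \<le> prefix_sum m" and a: "a \<ge> 0"
  shows "\<exists>c Us. c < m \<and> prefix_sum c < q \<and> q \<le> prefix_sum (Suc c) \<and> finite Us \<and> card Us \<le> 3 \<and> Us \<subseteq> {..<2 ^ L} \<and>
    (\<forall>N. (\<forall>u\<in>Us. good_path N a u) \<longrightarrow> accepts L N q a c \<and>
       (\<forall>b<m. accepts L N q a b \<longrightarrow> prefix_sum (Suc b) \<ge> q - 2 * a \<and> prefix_sum b \<le> q + 2 * a))"
proof -
  obtain c where c: "c < m" "prefix_sum c < q" "q \<le> prefix_sum (Suc c)" using prefix_sum_crossing[OF q] by blast
  obtain V where V: "finite V" "card V \<le> 1" "V \<subseteq> {..<m}"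
    and lower: "\<And>N b. \<forall>u\<in>V. good_path N a u \<Longrightarrow> accepts L N q a b \<Longrightarrow> prefix_sum (Suc b) \<ge> q - 2 * a"
  proof (cases "q - 2 * a \<le> 0")
    case True
    have "prefix_sum u \<ge> 0" for u using prefix_sum_mono[of 0 u] by (simp add: prefix_sum_def)
    then have "prefix_sum u \<ge> q - 2 * a" for u using True order_trans by blast
    then show ?thesis using that[of "{}"] by simp
  next
    case False
    then obtain v where v: "v < m" "prefix_sum v < q - 2 * a" "q - 2 * a \<le> prefix_sum (Suc v)"
      using prefix_sum_crossing[of "q - 2 * a" m] q a by auto
    have "prefix_sum (Suc b) \<ge> q - 2 * a" if g: "good_path N a v" and acc: "accepts L N q a b" for N b
    proof -
      have "v \<le> b" using good_path_rejects_below[OF g _ v(2), of b] acc v(1) m by fastforce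
      then show ?thesis using prefix_sum_mono[of "Suc v" "Suc b"] v(3) by simp
    qed
    then show ?thesis using that[of "{v}"] v(1) by simp
  qed
  obtain V' where V': "finite V'" "card V' \<le> 1" "V' \<subseteq> {..<m}"
    and upper: "\<And>N b. \<forall>u\<in>V'. good_path N a u \<Longrightarrow> b < m \<Longrightarrow> accepts L N q a b \<Longrightarrow> prefix_sum b \<le> q + 2 * a"
  proof (cases "prefix_sum m \<le> q + 2 * a")
    case True
    then have "prefix_sum b \<le> q + 2 * a" if "b < m" for b using prefix_sum_mono[of b m] that by simp
    then show ?thesis using that[of "{}"] by simp
  next
    case False
    then obtain v where v: "v < m" "prefix_sum v \<le> q + 2 * a" "q + 2 * a < prefix_sum (Suc v)"
      using prefix_sum_crossing_strict[of "q + 2 * a" m] q a by auto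
    have "prefix_sum b \<le> q + 2 * a" if g: "good_path N a v" and b: "b < m" and acc: "accepts L N q a b" for N b
    proof -
      have "b \<le> v" using good_path_rejects_above[OF g v(3), of b] acc b m by fastforce
      then show ?thesis using prefix_sum_mono[of b v] v(2) by simp
    qed
    then show ?thesis using that[of "{v}"] v(1) by simp
  qed
  have "card (insert c (V \<union> V')) \<le> 3"
    using card_insert_le_m1[of 3 "V \<union> V'" c] card_Un_le[of V V'] V(2) V'(2) by simp
  moreover have "insert c (V \<union> V') \<subseteq> {..<2 ^ L}" using c(1) V(3) V'(3) m by auto
  moreover have "accepts L N q a c" if "good_path N a c" for N
    using good_path_accepts[OF that] c m by simp
  moreover have "prefix_sum (Suc b) \<ge> q - 2 * a \<and> prefix_sum b \<le> q + 2 * a"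
    if "\<forall>u\<in>insert c (V \<union> V'). good_path N a u" "b < m" "accepts L N q a b" for N b
    using lower[of N b] upper[of N b] that by auto
  ultimately show ?thesis using c V(1) V'(1)
    by (intro exI[of _ c] exI[of _ "insert c (V \<union> V')"]) auto
qed

lemma AQ_from_sketch:
  assumes U: "U \<ge> 2" and \<epsilon>: "0 < \<epsilon>" "\<epsilon> < 1" and R: "R > 0" "1 - \<delta> \<le> 1 - 1 / 2 ^ R" and \<delta>: "\<delta> > 0"
  shows "\<exists>A. runs_in_memory ((real U / \<epsilon>) powr 3) A \<and>
           real (memory_size A) \<le> 11000 * real R * log 2 (real U) powr (3/2) / \<epsilon> \<and> solves_AQ \<epsilon> \<delta> U A"
proof -
  obtain L k where L: "Suc U < 2 ^ L" "real (2 ^ L) \<le> 4 * real U" and k: "k > 0" "128 * sqrt L / \<epsilon> \<le> 2 ^ k"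
    and mem: "real ((3 * k + 1) * L * R + Suc (R * (L * (3 * 2 ^ k)))) \<le> 11000 * real R * log 2 (real U) powr (3/2) / \<epsilon>"
    using sketch_size[OF U, of \<epsilon>] \<epsilon> R(1) by (metis less_imp_le)
  define acc where "acc q T N b \<longleftrightarrow> b \<in> {1..U} \<and> accepts L N (real q) (\<epsilon> * T / 2) b"
    for q :: nat and T :: real and N b
  \<comment> \<open>The size is the norm rounded up, so \<open>q\<close> can exceed the norm and
    have no quantile leaf. For \<open>q\<close> at or above the norm, \<open>U\<close> is an answer
    whenever one exists.\<close>
  define post where "post q T b = return_pmf (if T \<le> real q then U else b)" for q :: nat and T :: real and b :: nat
  have UL: "U < 2 ^ L" and W: "2 ^ L \<le> (real U / \<epsilon>) powr 3" using L word_bound[OF U \<epsilon>] by auto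
  obtain A where A: "memory_size A = (3 * k + 1) * L * R + Suc (R * (L * (3 * 2 ^ k)))" "runs_in_memory ((real U / \<epsilon>) powr 3) A"
    and resp: "\<And>\<sigma> q. strict_turnstile U \<sigma> \<Longrightarrow>
      (\<exists>p. response A \<sigma> q = bind_pmf p (post q (stream_rank \<sigma> U)) \<and> finite (set_pmf p) \<and>
        (\<forall>a G Us. stream_rank \<sigma> U > 0 \<longrightarrow> finite Us \<longrightarrow> card Us \<le> 3 \<longrightarrow> Us \<subseteq> {..<2 ^ L} \<longrightarrow>
          (\<forall>N. (\<forall>u\<in>Us. dyadic.good_path L (items U \<sigma>) N (\<epsilon> * stream_rank \<sigma> U / 2) u) \<longrightarrow>
             acc q (stream_rank \<sigma> U) N a \<and> (\<forall>b. acc q (stream_rank \<sigma> U) N b \<longrightarrow> b \<in> G)) \<longrightarrow>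
          measure_pmf.prob p G \<ge> 1 - 1 / 2 ^ R))"
    using amplified_sketch[OF UL W \<epsilon>(1) k, where R = R and acc = acc and post = post] by blast
  have "measure_pmf.prob (response A \<sigma> q) (quantile_answers \<epsilon> U \<sigma> q) \<ge> 1 - \<delta>"
    if \<sigma>: "strict_turnstile U \<sigma>" and q1: "q \<ge> 1" and ne: "quantile_answers \<epsilon> U \<sigma> q \<noteq> {}" for \<sigma> q
  proof -
    let ?T = "stream_rank \<sigma> U" and ?G = "quantile_answers \<epsilon> U \<sigma> q"
    obtain p where p: "response A \<sigma> q = bind_pmf p (post q ?T)" "finite (set_pmf p)"
      and good: "\<And>a G Us. ?T > 0 \<Longrightarrow> finite Us \<Longrightarrow> card Us \<le> 3 \<Longrightarrow> Us \<subseteq> {..<2 ^ L} \<Longrightarrow>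
          (\<And>N. (\<forall>u\<in>Us. dyadic.good_path L (items U \<sigma>) N (\<epsilon> * ?T / 2) u) \<Longrightarrow>
             acc q ?T N a \<and> (\<forall>b. acc q ?T N b \<longrightarrow> b \<in> G)) \<Longrightarrow>
          measure_pmf.prob p G \<ge> 1 - 1 / 2 ^ R"
      using resp[OF \<sigma>, of q] by (elim exE conjE) metis
    show ?thesis
    proof (cases "?T \<le> real q")
      case True
      have "0 \<le> \<epsilon> * real (stream_size U \<sigma>)" using \<epsilon> by simp
      then have "?T \<le> real q + \<epsilon> * real (stream_size U \<sigma>)" using True by linarith
      then have "U \<in> ?G" using top_answers_quantile[OF \<sigma> _ _ ne] U \<epsilon> by simp
      moreover have "post q ?T = (\<lambda>_. return_pmf U)" using True by (simp add: post_def fun_eq_iff)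
      ultimately show ?thesis using \<delta> by (simp add: p(1))
    next
      case False
      then have T: "?T > 0" using q1 by simp
      interpret dyadic L "items U \<sigma>" by (rule items_dyadic[OF \<sigma>])
      have pre: "prefix_sum (Suc u) = stream_rank \<sigma> u" if "u \<le> U" for u using prefix_sum_items[OF \<sigma> that] .
      obtain c Us where c: "c < Suc U" "prefix_sum c < real q" "real q \<le> prefix_sum (Suc c)"
        and Us: "finite Us" "card Us \<le> 3" "Us \<subseteq> {..<2 ^ L}"
        and acc: "\<And>N. \<forall>u\<in>Us. good_path N (\<epsilon> * ?T / 2) u \<Longrightarrow> accepts L N (real q) (\<epsilon> * ?T / 2) c \<and>
          (\<forall>b<Suc U. accepts L N (real q) (\<epsilon> * ?T / 2) b \<longrightarrow>
             prefix_sum (Suc b) \<ge> real q - 2 * (\<epsilon> * ?T / 2) \<and> prefix_sum b \<le> real q + 2 * (\<epsilon> * ?T / 2))"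
        using quantile_witnesses[of "Suc U" "real q" "\<epsilon> * ?T / 2"] L(1) q1 False pre[of U] \<epsilon> T by auto
      \<comment> \<open>Leaf 0 lies outside the universe; it has no weight and cannot be the
        quantile of \<open>q \<ge> 1\<close>.\<close>
      have "c \<noteq> 0"
      proof
        assume "c = 0"
        then show False using c(3) pre[of 0] q1 by (simp add: stream_rank_def)
      qed
      then have cU: "c \<in> {1..U}" using c(1) by simp
      have \<epsilon>n: "\<epsilon> * ?T \<le> \<epsilon> * real (stream_size U \<sigma>)"
        using stream_rank_le_size[OF \<sigma>] \<epsilon> by (intro mult_left_mono) auto
      have "1 - \<delta> \<le> 1 - 1 / 2 ^ R" by (rule R(2))
      also have "\<dots> \<le> measure_pmf.prob p ?G"
      proof (rule good[OF T Us, of c])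
        fix N assume N: "\<forall>u\<in>Us. good_path N (\<epsilon> * ?T / 2) u"
        have "b \<in> ?G" if b: "acc q ?T N b" for b
        proof -
          have b1: "b \<in> {1..U}" "accepts L N (real q) (\<epsilon> * ?T / 2) b" using b by (auto simp: acc_def)
          then have "prefix_sum (Suc b) \<ge> real q - \<epsilon> * ?T" "prefix_sum b \<le> real q + \<epsilon> * ?T"
            using acc[OF N] by auto
          moreover have "prefix_sum b = stream_rank \<sigma> (b - 1)" using pre[of "b - 1"] b1(1) by (cases b) auto
          ultimately show ?thesis using b1(1) pre[of b] \<epsilon>n by (auto simp: quantile_answers_def)
        qed
        then show "acc q ?T N c \<and> (\<forall>b. acc q ?T N b \<longrightarrow> b \<in> ?G)" using acc[OF N] cU by (simp add: acc_def)
      qed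
      also have "p = response A \<sigma> q"
      proof -
        have "post q ?T = return_pmf" using False by (simp add: post_def fun_eq_iff)
        then show ?thesis by (simp add: p(1) bind_return_pmf')
      qed
      finally show ?thesis .
    qed
  qed
  then have "solves_AQ \<epsilon> \<delta> U A" unfolding solves_AQ_def by auto
  then show ?thesis using A mem by (intro exI[of _ A]) simp
qed

lemma AQ_exists:
  assumes U: "U \<ge> 2" and \<epsilon>: "0 < \<epsilon>" "\<epsilon> < 1" and \<delta>: "0 < \<delta>" "\<delta> < 1"
  shows "\<exists>A. runs_in_memory ((real U / \<epsilon>) powr 3) A \<and>
     int (memory_size A) \<le> \<lceil>11000 * (log 2 (real U) powr (3/2) * log 2 (1 / (\<epsilon> * \<delta>)) / \<epsilon>
                              + log 2 (log 2 (real U)))\<rceil> \<and> solves_AQ \<epsilon> \<delta> U A"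
proof -
  let ?l = "log 2 (real U)" and ?D = "log 2 (1 / (\<epsilon> * \<delta>))"
  have l1: "?l \<ge> 1" using U by simp
  then have ll: "log 2 ?l \<ge> 0" by (simp add: zero_le_log_cancel_iff)
  have ed: "0 < \<epsilon> * \<delta>" "\<epsilon> * \<delta> < 1"
    using \<epsilon> \<delta> mult_strict_mono[of \<epsilon> 1 \<delta> 1] by auto
  show ?thesis
  proof (cases "\<epsilon> < 1/2")
    case True
    obtain R where R: "R > 0" "1 - \<delta> \<le> 1 - 1 / 2 ^ R" "real R \<le> log 2 (1 / \<delta>) + 1" using repetitions[OF \<delta>] by blast
    \<comment> \<open>For \<open>\<epsilon> < 1/2\<close> the summand
      \<open>log 2 (1 / \<epsilon>)\<close> of \<open>?D\<close> is at least 1 and absorbs the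
      rounding of \<open>R\<close>.\<close>
    have "log 2 2 \<le> log 2 (1 / \<epsilon>)" using True \<epsilon> by (intro log_le_cancel_iff[THEN iffD2]) (auto simp: field_simps)
    moreover have "?D = log 2 (1 / \<epsilon>) + log 2 (1 / \<delta>)" using \<epsilon> \<delta> by (simp add: log_divide log_mult)
    ultimately have RD: "real R \<le> ?D" using R(3) by simp
    obtain A where A: "runs_in_memory ((real U / \<epsilon>) powr 3) A"
      "real (memory_size A) \<le> 11000 * real R * ?l powr (3/2) / \<epsilon>" "solves_AQ \<epsilon> \<delta> U A"
      using AQ_from_sketch[OF U \<epsilon> R(1,2) \<delta>(1)] by blast
    note A(2)
    also have "11000 * real R * ?l powr (3/2) / \<epsilon> \<le> 11000 * ?D * ?l powr (3/2) / \<epsilon>"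
      using RD \<epsilon> by (intro divide_right_mono mult_right_mono mult_left_mono) auto
    also have "\<dots> \<le> 11000 * (?l powr (3/2) * ?D / \<epsilon> + log 2 ?l)" using ll by (simp add: mult_ac)
    finally have "int (memory_size A) \<le> \<lceil>11000 * (?l powr (3/2) * ?D / \<epsilon> + log 2 ?l)\<rceil>" by linarith
    then show ?thesis using A by blast
  next
    case False
    then obtain A where A: "runs_in_memory ((real U / \<epsilon>) powr 3) A" "memory_size A = 1" "solves_AQ \<epsilon> \<delta> U A"
      using AQ_from_norm[OF U, of \<epsilon> \<delta>] \<epsilon> \<delta> by auto
    have "?D > 0" using ed by (simp add: zero_less_log_cancel_iff)
    then have "0 < ?l powr (3/2) * ?D / \<epsilon>" using l1 \<epsilon> by simp
    with ll have "0 < 11000 * (?l powr (3/2) * ?D / \<epsilon> + log 2 ?l)" by (simp add: add_pos_nonneg)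
    then have "1 \<le> \<lceil>11000 * (?l powr (3/2) * ?D / \<epsilon> + log 2 ?l)\<rceil>" by linarith
    then show ?thesis using A by auto
  qed
qed

theorem theorem4p2:
  shows "(\<exists>C K :: real. \<forall>U::nat. \<forall>\<epsilon> \<delta> :: real.
            U \<ge> 2 \<longrightarrow> 0 < \<epsilon> \<longrightarrow> \<epsilon> < 1 \<longrightarrow> 0 < \<delta> \<longrightarrow> \<delta> < 1 \<longrightarrow>
            (\<exists>A :: (nat, real) streaming_alg.
               runs_in_memory ((real U / \<epsilon>) powr K) A \<and>
               int (memory_size A) \<le> \<lceil>C * (log 2 (real U) powr (3/2) * log 2 (1 / \<delta>) / \<epsilon>)\<rceil> \<and>
               solves_AR \<epsilon> \<delta> U A))
       \<and> (\<exists>C K :: real. \<forall>U::nat. \<forall>\<epsilon> \<delta> :: real.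
            U \<ge> 2 \<longrightarrow> 0 < \<epsilon> \<longrightarrow> \<epsilon> < 1 \<longrightarrow> 0 < \<delta> \<longrightarrow> \<delta> < 1 \<longrightarrow>
            (\<exists>A :: (nat, nat) streaming_alg.
               runs_in_memory ((real U / \<epsilon>) powr K) A \<and>
               int (memory_size A) \<le> \<lceil>C * (log 2 (real U) powr (3/2) * log 2 (1 / (\<epsilon> * \<delta>)) / \<epsilon>
                                      + log 2 (log 2 (real U)))\<rceil> \<and>
               solves_AQ \<epsilon> \<delta> U A))"
  using AR_exists AQ_exists by blast

end
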